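(* Let $0<\varepsilon<1/2$, $0<x<\varepsilon/(1+\varepsilon)^{m-1}$, and set $\Delta_k=(\iota_k)_*(\tilde\Delta_k)$ for $0\le k\le m$, twisted cycles in $M$ loaded by $u$. Then $$\int_{\Delta_0}u\varphi_0=\prod_{i=1}^m\frac{\Gamma(a_i)\Gamma(b_i-a_i)}{\Gamma(b_i)}\,f_0,$$ and for $1\le r\le m$, $$\int_{\Delta_r}u\varphi_0=e^{-\pi\sqrt{-1}(b_r-a_r-1)}\frac{\Gamma(b_r-1)\Gamma(1-a_0)}{\Gamma(b_r-a_0)}\prod_{\substack{1\le j\le m\\ j\neq r}}\frac{\Gamma(a_j-b_r+1)\Gamma(b_j-a_j)}{\Gamma(b_j-b_r+1)}\,f_r,$$ where $f_0={}_{m+1}F_m\!\left(\begin{matrix}a_0,\dots,a_m\\ b_1,\dots,b_m\end{matrix};x\right)$ and $f_r=x^{1-b_r}\,{}_{m+1}F_m\!\left(\begin{matrix}a_0-b_r+1,\dots,a_m-b_r+1\\ b_1-b_r+1,\dots,2-b_r,\dots,b_m-b_r+1\end{matrix};x\right)$ ($r$-th lower entry $2-b_r$), $x^{1-b_r}$ being the principal branch.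
   Context: Parameters $a_0,\dots,a_m,b_1,\dots,b_m\in\mathbb C$, $b_0:=0$, indices mod $m+1$ ($b_{m+1}=0$), satisfying $a_i-b_j\notin\mathbb Z$ ($0\le i,j\le m$), $b_i-b_j\notin\mathbb Z$ ($0\le i<j\le m$). ${}_{m+1}F_m$ is the generalized hypergeometric series $\sum_n\frac{\prod_i(\alpha_i,n)}{\prod_i(\beta_i,n)n!}x^n$, $(c,n)=\Gamma(c+n)/\Gamma(c)$. $M=\mathbb C^m\setminus\big(\bigcup_j\{t_j=0\}\cup\bigcup_{j=2}^m\{t_{j-1}=t_j\}\cup\{t_1=1\}\cup\{xt_m=1\}\big)$, $u=\prod_{j=1}^m t_j^{a_j-b_{j+1}}\prod_{j=2}^m(t_{j-1}-t_j)^{b_j-a_j}(1-t_1)^{b_1-a_1}(1-xt_m)^{-a_0}$, $\varphi_0=dt_1\wedge\cdots\wedge dt_m/(t_m(1-t_1)\prod_{j=2}^m(t_{j-1}-t_j))$. With $z_0:=1$: $M_k$, $u_k$, $\tilde\Delta_k$ are as follows. $M_k=\mathbb C^m\setminus\big(\bigcup_{j=1}^m\{z_j(1-z_j)=0\}\cup\{z_k=x\prod_{j\ne k}z_j\}\big)$, $u_k=\prod_{j\ne k}z_j^{a_j-b_k}(1-z_j)^{b_j-a_j}\cdot z_k^{a_k}(1-z_k)^{-a_0}(z_k-x\prod_{j\ne k}z_j)^{b_k-a_k}$ (products over $1\le j\le m$, $j\ne k$). $\tilde\Delta_k$ is the regularization $\prod_{j=1}^m\big(\frac{1}{e^{2\pi\sqrt{-1}e^{(0)}_j}-1}S_j(0)+[\varepsilon,1-\varepsilon]_j-\frac{1}{e^{2\pi\sqrt{-1}e^{(1)}_j}-1}S_j(1)\big)\otimes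 u_k$ of the cube $[\varepsilon,1-\varepsilon]^m$ (standard orientation, branch of $u_k$ with all factor arguments $0$ there), where $S_j(0),S_j(1)$ are the positively oriented radius-$\varepsilon$ circles around $z_j=0$ (from $\varepsilon$) and $z_j=1$ (from $1-\varepsilon$), and exponents $e^{(0)}_j=a_j-b_k$, $e^{(1)}_j=b_j-a_j$ for $j\ne k$, $e^{(0)}_k=b_k$, $e^{(1)}_k=-a_0$ for $k\ne 0$. Maps $\iota_k:M_k\to M$: $\iota_0(z)=t$ with $t_s=\prod_{i=1}^s z_i$; for $1\le r\le m$, $\iota_r(z)=t$ with $t_s=\prod_{j=1}^s z_j$ ($s<r$), $t_s=z_r/(x\prod_{j=s+1}^m z_j)$ ($s\ge r$). Branch of $u$ on $\Delta_k$: for $k=0$, $\iota_0([\varepsilon,1-\varepsilon]^m)\subset D=\{0<t_m<\cdots<t_1<1\}$ and all factors of $u$ have argument $0$ there; for $1\le r\le m$, $\iota_r([\varepsilon,1-\varepsilon]^m)$ lies in the real chamber $D_r=\{t_j>0,\ 1-xt_m>0,\ t_{j-1}-t_j>0\ (j\ne r),\ t_{r-1}-t_r<0\}$ ($t_0=1$), where all factors have argument $0$ except $\arg(t_{r-1}-t_r)=-\pi$; i.e. $u=e^{-\pi\sqrt{-1}(b_r-a_r)}(t_r-t_{r-1})^{b_r-a_r}(1-xt_m)^{-a_0}\prod_j t_j^{a_j-b_{j+1}}\prod_{j\ne r}(t_{j-1}-t_j)^{b_j-a_j}$ with positive real bases taken with argument $0$. The branch is then continued along the regularization. *)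

theory Defs
  imports "HOL-Analysis.Analysis"
begin

definition hypergeom :: "nat \<Rightarrow> (nat \<Rightarrow> complex) \<Rightarrow> (nat \<Rightarrow> complex) \<Rightarrow> complex \<Rightarrow> complex" where
  "hypergeom m \<alpha> \<beta> z =
     (\<Sum>n. (\<Prod>i=0..m. pochhammer (\<alpha> i) n) / ((\<Prod>i=1..m. pochhammer (\<beta> i) n) * fact n) * z ^ n)"

text \<open>The maps iota_k : M_k -> M (coordinates indexed 1..m; t 0 = empty product = 1).\<close>
definition iota :: "nat \<Rightarrow> real \<Rightarrow> nat \<Rightarrow> (nat \<Rightarrow> complex) \<Rightarrow> nat \<Rightarrow> complex" where
  "iota m x k z = (\<lambda>s. if k = 0 \<or> s < k then (\<Prod>j=1..s. z j)
                        else z k / (complex_of_real x * (\<Prod>j=s+1..m. z j)))"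

definition reg_path :: "real \<Rightarrow> nat \<Rightarrow> real \<Rightarrow> complex" where
  "reg_path \<epsilon> c \<sigma> =
     (if c = 0 then complex_of_real \<epsilon> * exp (2 * pi * \<i> * \<sigma>)
      else if c = 1 then complex_of_real (\<epsilon> + (1 - 2 * \<epsilon>) * \<sigma>)
      else 1 - complex_of_real \<epsilon> * exp (2 * pi * \<i> * \<sigma>))"

definition reg_cell :: "real \<Rightarrow> (nat \<Rightarrow> nat) \<Rightarrow> (nat \<Rightarrow> real) \<Rightarrow> nat \<Rightarrow> complex" where
  "reg_cell \<epsilon> c s = (\<lambda>j. reg_path \<epsilon> (c j) (s j))"

text \<open>Local exponents e^(0)_j, e^(1)_j of u_k (with b 0 = 0).\<close>
definition expo0 :: "(nat \<Rightarrow> complex) \<Rightarrow> (nat \<Rightarrow> complex) \<Rightarrow> nat \<Rightarrow> nat \<Rightarrow> complex" where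
  "expo0 a b k j = (if j = k then b k else a j - b k)"

definition expo1 :: "(nat \<Rightarrow> complex) \<Rightarrow> (nat \<Rightarrow> complex) \<Rightarrow> nat \<Rightarrow> nat \<Rightarrow> complex" where
  "expo1 a b k j = (if j = k then - a 0 else b j - a j)"

definition reg_coef :: "(nat \<Rightarrow> complex) \<Rightarrow> (nat \<Rightarrow> complex) \<Rightarrow> nat \<Rightarrow> nat \<Rightarrow> nat \<Rightarrow> complex" where
  "reg_coef a b k j cj =
     (if cj = 0 then 1 / (exp (2 * pi * \<i> * expo0 a b k j) - 1)
      else if cj = 1 then 1
      else - 1 / (exp (2 * pi * \<i> * expo1 a b k j) - 1))"

definition pcube :: "nat \<Rightarrow> (nat \<Rightarrow> real) set" where
  "pcube m = PiE {1..m} (\<lambda>_. {0..1})"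

definition pbase :: "nat \<Rightarrow> nat \<Rightarrow> real" where
  "pbase m = restrict (\<lambda>_. 0) {1..m}"

definition cont_log :: "'a::topological_space set \<Rightarrow> 'a \<Rightarrow> ('a \<Rightarrow> complex) \<Rightarrow> complex \<Rightarrow> 'a \<Rightarrow> complex" where
  "cont_log S s0 g l0 s =
     (THE v. \<exists>L. continuous_on S L \<and> (\<forall>y\<in>S. exp (L y) = g y) \<and> L s0 = l0 \<and> L s = v)"

definition log_arg0 :: "complex \<Rightarrow> complex" where
  "log_arg0 v = complex_of_real (ln (cmod v))"

definition log_argmpi :: "complex \<Rightarrow> complex" where
  "log_argmpi v = complex_of_real (ln (cmod v)) - complex_of_real pi * \<i>"

text \<open>Branch of u along the cell T = iota_k o (reg_cell c), continued from the base point,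
  where u has the branch prescribed on the chamber D (k = 0), resp. D_k (k >= 1):
  all factors have argument 0 except arg(t_(k-1) - t_k) = -pi for k >= 1.
  Factors: t_j (exponent a_j - b_(j+1), b_(m+1) = 0), t_(j-1) - t_j (exponent b_j - a_j, t_0 = 1),
  and 1 - x t_m (exponent -a_0).\<close>
definition u_branch ::
  "nat \<Rightarrow> (nat \<Rightarrow> complex) \<Rightarrow> (nat \<Rightarrow> complex) \<Rightarrow> real \<Rightarrow> nat
    \<Rightarrow> ((nat \<Rightarrow> real) \<Rightarrow> nat \<Rightarrow> complex) \<Rightarrow> (nat \<Rightarrow> real) \<Rightarrow> complex" where
  "u_branch m a b x k T s =
     (let S = pcube m; s0 = pbase m;
          Lx = cont_log S s0 (\<lambda>y. 1 - complex_of_real x * T y m) (log_arg0 (1 - complex_of_real x * T s0 m)) s;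
          Lt = (\<lambda>j. cont_log S s0 (\<lambda>y. T y j) (log_arg0 (T s0 j)) s);
          Ld = (\<lambda>j. cont_log S s0 (\<lambda>y. T y (j - 1) - T y j)
                   ((if j = k then log_argmpi else log_arg0) (T s0 (j - 1) - T s0 j)) s)
      in exp (- a 0 * Lx
              + (\<Sum>j=1..m. (a j - (if j = m then 0 else b (j + 1))) * Lt j)
              + (\<Sum>j=1..m. (b j - a j) * Ld j)))"

text \<open>Coefficient of phi_0 = dt_1 ^ ... ^ dt_m / (t_m (1 - t_1) prod_(j=2..m) (t_(j-1) - t_j)).\<close>
definition phi0_coef :: "nat \<Rightarrow> (nat \<Rightarrow> complex) \<Rightarrow> complex" where
  "phi0_coef m t = 1 / (t m * (\<Prod>j=1..m. t (j - 1) - t j))"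

definition detn :: "nat \<Rightarrow> (nat \<Rightarrow> nat \<Rightarrow> complex) \<Rightarrow> complex" where
  "detn m A = (\<Sum>p | p permutes {1..m}. of_int (sign p) * (\<Prod>i=1..m. A i (p i)))"

definition jacob :: "((nat \<Rightarrow> real) \<Rightarrow> nat \<Rightarrow> complex) \<Rightarrow> (nat \<Rightarrow> real) \<Rightarrow> nat \<Rightarrow> nat \<Rightarrow> complex" where
  "jacob T s i j = vector_derivative (\<lambda>\<sigma>. T (s(j := \<sigma>)) i) (at (s j))"

definition cell_integral ::
  "nat \<Rightarrow> (nat \<Rightarrow> complex) \<Rightarrow> (nat \<Rightarrow> complex) \<Rightarrow> real \<Rightarrow> real \<Rightarrow> nat \<Rightarrow> (nat \<Rightarrow> nat) \<Rightarrow> complex" where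
  "cell_integral m a b x \<epsilon> k c =
     (let T = (\<lambda>s. iota m x k (reg_cell \<epsilon> c s))
      in integral\<^sup>L (PiM {1..m} (\<lambda>_. lebesgue_on {0..1}))
           (\<lambda>s. u_branch m a b x k T s * phi0_coef m (T s) * detn m (jacob T s)))"

definition twisted_integral ::
  "nat \<Rightarrow> (nat \<Rightarrow> complex) \<Rightarrow> (nat \<Rightarrow> complex) \<Rightarrow> real \<Rightarrow> real \<Rightarrow> nat \<Rightarrow> complex" where
  "twisted_integral m a b x \<epsilon> k =
     (\<Sum>c\<in>PiE {1..m} (\<lambda>_. {0,1,2}).
        (\<Prod>j=1..m. reg_coef a b k j (c j)) * cell_integral m a b x \<epsilon> k c)"

end

theory Submission
  imports Defs "HOL-Complex_Analysis.Complex_Analysis"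
begin

text \<open>
  In the coordinates \<open>z\<close> the form \<open>u phi_0\<close> becomes, up to a constant, a product of one-variable Beta
  integrands in \<open>z_j\<close> and \<open>1 - z_j\<close> times a power \<open>(1 - Q)\<^sup>-\<^sup>\<alpha>\<close>, where \<open>Q = x \<Prod>z_j\<close> for \<open>k = 0\<close> and
  \<open>Q = x (\<Prod>j\<noteq>k. z_j) / z_k\<close> for \<open>k > 0\<close>. The smallness of \<open>x\<close> makes \<open>|Q|\<close> bounded away from \<open>1\<close> on all
  cells, so the binomial series of this power may be integrated termwise. Each term factors into
  one-variable regularized integrals, whose value is \<open>\<Gamma>(p) \<Gamma>(q) / \<Gamma>(p + q)\<close>: for
  \<open>0 < p, q < 1\<close> the contour collapses onto \<open>[0,1]\<close>, and both sides are holomorphic in \<open>p\<close> and in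
  \<open>q\<close> away from the integers. Shifting the Gamma arguments by \<open>n\<close> gives the hypergeometric coefficients.
\<close>

section \<open>The regularized Beta integral\<close>

text \<open>Two obstacles shape the proof. First, the regularizing coefficients belong to the
  exponents of \<open>u_k\<close>, while the Beta parameters differ from these by integers:
  \<open>phi_0\<close> shifts them when k > 0, and so does every power of Q. Since
  \<open>exp (2 * pi * \<i> * p)\<close> sees p only modulo integers, the same coefficients serve
  every term of the series. Second, the branch of u is given by abstract continuous logarithms of
  its factors in t. The maps \<open>iota\<close> are monomial, so each factor is, up to a constant,
  a product of powers of z_j, 1 - z_j and 1 - Q. Explicit logarithms of these three, normalised at a
  corner of the cube, identify the branch because the cube is connected. Monomiality also reduces
  the Jacobian to an exponent matrix of determinant 1, so no orientation sign appears. For r > 0 the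
  relation t_(r-1) = t_r Q takes the place of t_r = t_(r-1) z_r. It is the source of the constant
  e^(-pi i (b_r - a_r - 1)), of x^(1 - b_r) and of the common shift of the hypergeometric
  parameters.\<close>

definition zlog :: "real \<Rightarrow> nat \<Rightarrow> real \<Rightarrow> complex" where
  "zlog \<epsilon> c \<sigma> =
     (if c = 0 then of_real (ln \<epsilon>) + 2 * pi * \<i> * \<sigma>
      else if c = 1 then of_real (ln (\<epsilon> + (1 - 2 * \<epsilon>) * \<sigma>))
      else Ln (1 - complex_of_real \<epsilon> * exp (2 * pi * \<i> * \<sigma>)))"

text \<open>Together with \<open>zlog\<close>, the logarithms of 1 - z and z along the three pieces
  of the contour. On a circle, the logarithm of the encircled factor is affine in \<sigma> and
  carries the monodromy; the other factor stays in the right half plane, so the principal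
  \<open>Ln\<close> is continuous there.\<close>

definition wlog :: "real \<Rightarrow> nat \<Rightarrow> real \<Rightarrow> complex" where
  "wlog \<epsilon> c \<sigma> =
     (if c = 0 then Ln (1 - complex_of_real \<epsilon> * exp (2 * pi * \<i> * \<sigma>))
      else if c = 1 then of_real (ln (1 - (\<epsilon> + (1 - 2 * \<epsilon>) * \<sigma>)))
      else of_real (ln \<epsilon>) + 2 * pi * \<i> * \<sigma>)"

definition reg_speed :: "real \<Rightarrow> nat \<Rightarrow> real \<Rightarrow> complex" where
  "reg_speed \<epsilon> c \<sigma> =
     (if c = 0 then 2 * pi * \<i> * (complex_of_real \<epsilon> * exp (2 * pi * \<i> * \<sigma>))
      else if c = 1 then complex_of_real (1 - 2 * \<epsilon>)
      else - (2 * pi * \<i> * (complex_of_real \<epsilon> * exp (2 * pi * \<i> * \<sigma>))))"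

lemma norm_circle: "0 < \<epsilon> \<Longrightarrow> norm (complex_of_real \<epsilon> * exp (2 * pi * \<i> * complex_of_real \<sigma>)) = \<epsilon>"
  by (simp add: norm_mult)

lemma Re_circle_less:
  assumes "0 < \<epsilon>" "\<epsilon> < 1"
  shows "Re (1 - complex_of_real \<epsilon> * exp (2 * pi * \<i> * complex_of_real \<sigma>)) > 0"
  using complex_Re_le_cmod[of "complex_of_real \<epsilon> * exp (2 * pi * \<i> * complex_of_real \<sigma>)"]
    norm_circle[OF assms(1), of \<sigma>] assms
  by (simp only: minus_complex.sel one_complex.sel)

lemma segment_bounds:
  fixes \<epsilon> \<sigma> :: real
  assumes "0 < \<epsilon>" "\<epsilon> < 1/2" "\<sigma> \<in> {0..1}"
  shows "\<epsilon> \<le> \<epsilon> + (1 - 2 * \<epsilon>) * \<sigma>" "\<epsilon> + (1 - 2 * \<epsilon>) * \<sigma> \<le> 1 - \<epsilon>"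
proof -
  have "(1 - 2 * \<epsilon>) * \<sigma> \<le> (1 - 2 * \<epsilon>) * 1" using assms by (intro mult_left_mono) auto
  then show "\<epsilon> + (1 - 2 * \<epsilon>) * \<sigma> \<le> 1 - \<epsilon>" by simp
  show "\<epsilon> \<le> \<epsilon> + (1 - 2 * \<epsilon>) * \<sigma>" using assms by simp
qed

lemma exp_zlog:
  assumes "0 < \<epsilon>" "\<epsilon> < 1/2" "\<sigma> \<in> {0..1}"
  shows "exp (zlog \<epsilon> c \<sigma>) = reg_path \<epsilon> c \<sigma>"
proof -
  have "1 - complex_of_real \<epsilon> * exp (2 * pi * \<i> * complex_of_real \<sigma>) \<noteq> 0"
    using Re_circle_less[of \<epsilon> \<sigma>] assms by fastforce
  then show ?thesis
    using assms less_le_trans[OF assms(1) segment_bounds(1)[OF assms]]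
    by (simp add: zlog_def reg_path_def exp_add exp_of_real exp_Ln del: of_real_add of_real_mult of_real_diff)
qed

lemma exp_wlog:
  assumes "0 < \<epsilon>" "\<epsilon> < 1/2" "\<sigma> \<in> {0..1}"
  shows "exp (wlog \<epsilon> c \<sigma>) = 1 - reg_path \<epsilon> c \<sigma>"
proof -
  have "1 - complex_of_real \<epsilon> * exp (2 * pi * \<i> * complex_of_real \<sigma>) \<noteq> 0"
    using Re_circle_less[of \<epsilon> \<sigma>] assms by fastforce
  then show ?thesis
    using assms segment_bounds[OF assms]
    by (simp add: wlog_def reg_path_def exp_add exp_of_real exp_Ln)
qed

lemma reg_path_nonzero:
  assumes "0 < \<epsilon>" "\<epsilon> < 1/2" "\<sigma> \<in> {0..1}"
  shows "reg_path \<epsilon> c \<sigma> \<noteq> 0"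
  using exp_zlog[OF assms, of c] by (metis exp_not_eq_zero)

lemma circle_log_continuous:
  assumes "0 < \<epsilon>" "\<epsilon> < 1/2"
  shows "continuous_on S (\<lambda>\<sigma>. Ln (1 - complex_of_real \<epsilon> * exp (2 * pi * \<i> * complex_of_real \<sigma>)))"
proof (intro continuous_intros)
  fix \<sigma> assume "\<sigma> \<in> S"
  show "1 - complex_of_real \<epsilon> * exp (2 * pi * \<i> * complex_of_real \<sigma>) \<notin> \<real>\<^sub>\<le>\<^sub>0"
    using Re_circle_less[of \<epsilon> \<sigma>] assms
    by (auto simp: complex_nonpos_Reals_iff)
qed

lemma continuous_on_zlog:
  assumes "0 < \<epsilon>" "\<epsilon> < 1/2"
  shows "continuous_on {0..1} (zlog \<epsilon> c)"
proof -
  have *: "0 < \<epsilon> + (1 - 2 * \<epsilon>) * \<sigma>" if "\<sigma> \<in> {0..1}" for \<sigma>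
    using segment_bounds[OF assms that] assms by simp
  consider "c = 0" | "c = 1" | "c \<noteq> 0 \<and> c \<noteq> 1" by blast
  then show ?thesis
  proof cases
    case 2
    then show ?thesis unfolding zlog_def using *
      by (force intro!: continuous_intros)
  qed (use circle_log_continuous[OF assms] in \<open>auto simp: zlog_def intro!: continuous_intros\<close>)
qed

lemma continuous_on_wlog:
  assumes "0 < \<epsilon>" "\<epsilon> < 1/2"
  shows "continuous_on {0..1} (wlog \<epsilon> c)"
proof -
  have *: "0 < 1 - (\<epsilon> + (1 - 2 * \<epsilon>) * \<sigma>)" if "\<sigma> \<in> {0..1}" for \<sigma>
    using segment_bounds[OF assms that] assms by simp
  consider "c = 0" | "c = 1" | "c \<noteq> 0 \<and> c \<noteq> 1" by blast
  then show ?thesis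
  proof cases
    case 2
    then show ?thesis unfolding wlog_def using *
      by (force intro!: continuous_intros)
  qed (use circle_log_continuous[OF assms] in \<open>auto simp: wlog_def intro!: continuous_intros\<close>)
qed

lemma continuous_on_reg_speed: "continuous_on S (reg_speed \<epsilon> c)"
  by (cases "c = 0"; cases "c = 1") (auto simp: reg_speed_def intro!: continuous_intros)

lemma reg_path_has_vector_derivative:
  "(reg_path \<epsilon> c has_vector_derivative reg_speed \<epsilon> c \<sigma>) (at \<sigma> within S)"
proof -
  have circle: "((\<lambda>\<sigma>. complex_of_real \<epsilon> * exp (2 * pi * \<i> * complex_of_real \<sigma>)) has_vector_derivative
      2 * pi * \<i> * (complex_of_real \<epsilon> * exp (2 * pi * \<i> * complex_of_real \<sigma>))) (at \<sigma> within S)"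
    by (rule has_vector_derivative_real_field[of "\<lambda>w. complex_of_real \<epsilon> * exp (2 * pi * \<i> * w)"])
       (auto intro!: derivative_eq_intros)
  have segment: "((\<lambda>\<sigma>. complex_of_real (\<epsilon> + (1 - 2 * \<epsilon>) * \<sigma>)) has_vector_derivative
      complex_of_real (1 - 2 * \<epsilon>)) (at \<sigma> within S)"
    by (auto intro!: derivative_eq_intros has_vector_derivative_of_real
        simp: has_real_derivative_iff_has_vector_derivative[symmetric])
  consider "c = 0" | "c = 1" | "c \<noteq> 0 \<and> c \<noteq> 1" by blast
  then show ?thesis
  proof cases
    case 1 then show ?thesis using circle by (simp add: reg_path_def[abs_def] reg_speed_def)
  next
    case 2 then show ?thesis using segment by (simp add: reg_path_def[abs_def] reg_speed_def)
  next
    case 3 then show ?thesis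
      using has_vector_derivative_diff[OF has_vector_derivative_const[of 1] circle]
      by (simp add: reg_path_def[abs_def] reg_speed_def)
  qed
qed

section \<open>The three pieces of the contour and a primitive near the end points\<close>

definition beta_cell :: "real \<Rightarrow> nat \<Rightarrow> complex \<Rightarrow> complex \<Rightarrow> complex" where
  "beta_cell \<epsilon> c p q =
     integral {0..1} (\<lambda>\<sigma>. exp ((p - 1) * zlog \<epsilon> c \<sigma> + (q - 1) * wlog \<epsilon> c \<sigma>) * reg_speed \<epsilon> c \<sigma>)"

definition reg_beta :: "real \<Rightarrow> complex \<Rightarrow> complex \<Rightarrow> complex" where
  "reg_beta \<epsilon> p q =
     1 / (exp (2 * pi * \<i> * p) - 1) * beta_cell \<epsilon> 0 p q + beta_cell \<epsilon> 1 p q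
     - 1 / (exp (2 * pi * \<i> * q) - 1) * beta_cell \<epsilon> 2 p q"

text \<open>Replacing z by 1 - z exchanges the two circles and the two logarithms and reverses the
  velocity, so only the loop around 0 has to be evaluated.\<close>

lemma beta_cell_2: "beta_cell \<epsilon> 2 p q = - beta_cell \<epsilon> 0 q p"
  by (simp add: beta_cell_def zlog_def wlog_def reg_speed_def add.commute flip: integral_neg)

text \<open>The power series \<open>H\<close> with \<open>p H + z H' = (1 - z)\<^sup>q\<^sup>-\<^sup>1\<close>, so that \<open>z\<^sup>p H\<close> is a primitive of
  the Beta integrand near \<open>0\<close>.\<close>
definition inc_beta :: "complex \<Rightarrow> complex \<Rightarrow> complex \<Rightarrow> complex" where
  "inc_beta p q z = (\<Sum>n. ((q - 1) gchoose n) * (-1) ^ n / (p + of_nat n) * z ^ n)"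

lemma one_minus_powr_sums:
  fixes z :: complex
  assumes "norm z < 1"
  shows "(\<lambda>n. (a gchoose n) * (-1) ^ n * z ^ n) sums (1 - z) powr a"
  using gen_binomial_complex[of "- z" a] assms
  by (simp add: power_minus[of z] mult.assoc)

lemma summable_norm_one_minus_powr:
  fixes z :: complex
  assumes z: "norm z < 1"
  shows "summable (\<lambda>n. norm ((a gchoose n) * (-1) ^ n * z ^ n))"
proof -
  obtain R where R: "norm z < R" "R < 1" using dense[OF z] by blast
  have R0: "0 < R" using R norm_ge_zero[of z] by linarith
  have "summable (\<lambda>n. (a gchoose n) * (-1) ^ n * complex_of_real R ^ n)"
    using one_minus_powr_sums[of "complex_of_real R" a] R R0 by (auto simp: sums_iff)
  then show ?thesis
    by (rule powser_insidea) (use R R0 in auto)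
qed

text \<open>Once n exceeds |p| + 1, the denominator p + n has modulus at least 1, and the absolutely
  convergent binomial series dominates.\<close>

lemma summable_inc_beta:
  fixes z :: complex
  assumes p: "p \<notin> \<int>" and z: "norm z < 1"
  shows "summable (\<lambda>n. ((q - 1) gchoose n) * (-1) ^ n / (p + of_nat n) * z ^ n)"
proof -
  have s: "summable (\<lambda>n. norm (((q - 1) gchoose n) * (-1) ^ n * z ^ n))"
    by (rule summable_norm_one_minus_powr[OF z])
  have "eventually (\<lambda>n. norm (p + of_nat n) \<ge> 1) sequentially"
  proof -
    obtain N where N: "real N > norm p + 1" using reals_Archimedean2 by blast
    have "norm (p + of_nat n) \<ge> 1" if "n \<ge> N" for n
    proof -
      have "norm (p + of_nat n) \<ge> norm (of_nat n :: complex) - norm p"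
        by (metis add.commute norm_diff_ineq)
      then show ?thesis using N that by (simp add: of_nat_mono) 
    qed
    then show ?thesis by (auto simp: eventually_sequentially)
  qed
  then have "eventually (\<lambda>n. norm (((q - 1) gchoose n) * (-1) ^ n / (p + of_nat n) * z ^ n)
      \<le> norm (((q - 1) gchoose n) * (-1) ^ n * z ^ n)) sequentially"
  proof eventually_elim
    case (elim n)
    show ?case using elim
      using mult_left_mono[OF elim, of "norm (((q - 1) gchoose n) * (-1) ^ n * z ^ n)"]
      by (simp add: norm_mult norm_divide norm_power divide_simps)
  qed
  then show ?thesis by (rule summable_comparison_test_ev[OF _ s])
qed

text \<open>Termwise, p + n cancels the denominator of the n-th coefficient and leaves the binomial
  series. Only this differential equation is used later, so the derivative is merely
  obtained.\<close>

lemma inc_beta_deriv: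
  assumes p: "p \<notin> \<int>" and z: "norm z < 1"
  obtains D where "(inc_beta p q has_field_derivative D) (at z)"
    "p * inc_beta p q z + z * D = (1 - z) powr (q - 1)"
proof -
  let ?c = "\<lambda>n. ((q - 1) gchoose n) * (-1) ^ n / (p + of_nat n)"
  obtain R where R: "norm z < R" "R < 1" using dense[OF z] by blast
  have R0: "0 < R" using R norm_ge_zero[of z] by linarith
  have sR: "summable (\<lambda>n. ?c n * complex_of_real R ^ n)"
    by (rule summable_inc_beta[OF p]) (use R R0 in auto)
  define D where "D = (\<Sum>n. diffs ?c n * z ^ n)"
  have D: "(inc_beta p q has_field_derivative D) (at z)"
    unfolding D_def inc_beta_def
    by (rule termdiffs_strong[OF sR]) (use R R0 in auto)
  have pn: "p + of_nat n \<noteq> 0" for n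
  proof
    assume "p + of_nat n = 0"
    then have "p = - of_nat n" by (simp add: eq_neg_iff_add_eq_0)
    then show False using p by auto
  qed
  have sd: "summable (\<lambda>n. diffs ?c n * z ^ n)"
    by (rule termdiff_converges[of _ 1]) (use z summable_inc_beta[OF p] in auto)
  have s1: "(\<lambda>n. of_nat n * ?c n * z ^ (n - 1)) sums D"
    using diffs_equiv[OF sd] by (simp add: D_def)
  have s2: "(\<lambda>n. p * (?c n * z ^ n)) sums (p * inc_beta p q z)"
    unfolding inc_beta_def
    by (intro sums_mult summable_sums summable_inc_beta[OF p z])
  have "(\<lambda>n. p * (?c n * z ^ n) + z * (of_nat n * ?c n * z ^ (n - 1))) sums (p * inc_beta p q z + z * D)"
    by (intro sums_add s2 sums_mult s1)
  also have "(\<lambda>n. p * (?c n * z ^ n) + z * (of_nat n * ?c n * z ^ (n - 1)))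
     = (\<lambda>n. ((q - 1) gchoose n) * (-1) ^ n * z ^ n)"
  proof
    fix n
    have "z * (of_nat n * ?c n * z ^ (n - 1)) = of_nat n * (?c n * z ^ n)"
      by (cases n) (auto simp: field_simps simp del: of_nat_Suc)
    then have "p * (?c n * z ^ n) + z * (of_nat n * ?c n * z ^ (n - 1)) = (p + of_nat n) * ?c n * z ^ n"
      by (simp only: distrib_right mult.assoc)
    then show "p * (?c n * z ^ n) + z * (of_nat n * ?c n * z ^ (n - 1))
       = ((q - 1) gchoose n) * (-1) ^ n * z ^ n"
      using pn[of n] by simp
  qed
  finally have "p * inc_beta p q z + z * D = (1 - z) powr (q - 1)"
    using one_minus_powr_sums[OF z] sums_unique2 by blast
  then show ?thesis using that D by blast
qed

text \<open>Along the loop z^p H is a primitive. After one turn H has returned to its value while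
  z^p has gained e^(2 pi i p); the difference is exactly the factor that the regularizing
  coefficient divides out.\<close>

lemma beta_cell_0:
  assumes e: "0 < \<epsilon>" "\<epsilon> < 1/2" and p: "p \<notin> \<int>"
  shows "beta_cell \<epsilon> 0 p q =
    (exp (2 * pi * \<i> * p) - 1) * (exp (p * of_real (ln \<epsilon>)) * inc_beta p q (of_real \<epsilon>))"
proof -
  let ?z = "\<lambda>\<sigma>. complex_of_real \<epsilon> * exp (2 * pi * \<i> * complex_of_real \<sigma>)"
  let ?l = "\<lambda>\<sigma>. complex_of_real (ln \<epsilon>) + 2 * pi * \<i> * complex_of_real \<sigma>"
  have "((\<lambda>\<sigma>. exp (p * ?l \<sigma>) * inc_beta p q (?z \<sigma>)) has_vector_derivative
      exp ((p - 1) * zlog \<epsilon> 0 \<sigma> + (q - 1) * wlog \<epsilon> 0 \<sigma>) * reg_speed \<epsilon> 0 \<sigma>) (at \<sigma> within {0..1})" for \<sigma>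
  proof -
    have z1: "norm (?z \<sigma>) < 1" using norm_circle[OF e(1), of \<sigma>] e by simp
    obtain D where D: "(inc_beta p q has_field_derivative D) (at (?z \<sigma>))"
      "p * inc_beta p q (?z \<sigma>) + ?z \<sigma> * D = (1 - ?z \<sigma>) powr (q - 1)"
      using inc_beta_deriv[OF p z1] by blast
    have nz: "1 - ?z \<sigma> \<noteq> 0" using z1 by auto
    have el: "exp (?l \<sigma>) = ?z \<sigma>" using e by (simp add: exp_add exp_of_real)
    have ep: "exp (p * ?l \<sigma>) = exp ((p - 1) * ?l \<sigma>) * ?z \<sigma>"
      unfolding el[symmetric] exp_add[symmetric] by (simp add: algebra_simps)
    have dz: "((\<lambda>w. complex_of_real \<epsilon> * exp (2 * pi * \<i> * w)) has_field_derivative 2 * pi * \<i> * ?z \<sigma>) (at (of_real \<sigma>))"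
      by (auto intro!: derivative_eq_intros)
    have dH: "((\<lambda>w. inc_beta p q (complex_of_real \<epsilon> * exp (2 * pi * \<i> * w))) has_field_derivative D * (2 * pi * \<i> * ?z \<sigma>)) (at (of_real \<sigma>))"
      using DERIV_chain2[of "inc_beta p q" D "\<lambda>w. complex_of_real \<epsilon> * exp (2 * pi * \<i> * w)", OF D(1) dz] .
    have dE: "((\<lambda>w. exp (p * (complex_of_real (ln \<epsilon>) + 2 * pi * \<i> * w))) has_field_derivative exp (p * ?l \<sigma>) * (p * (2 * pi * \<i>))) (at (of_real \<sigma>))"
      by (auto intro!: derivative_eq_intros)
    have "((\<lambda>\<sigma>. exp (p * ?l \<sigma>) * inc_beta p q (?z \<sigma>)) has_vector_derivative
       exp (p * ?l \<sigma>) * (D * (2 * pi * \<i> * ?z \<sigma>)) + exp (p * ?l \<sigma>) * (p * (2 * pi * \<i>)) * inc_beta p q (?z \<sigma>)) (at \<sigma> within {0..1})"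
      by (rule has_vector_derivative_real_field
          [of "\<lambda>w. exp (p * (complex_of_real (ln \<epsilon>) + 2 * pi * \<i> * w)) * inc_beta p q (complex_of_real \<epsilon> * exp (2 * pi * \<i> * w))"])
         (rule DERIV_mult'[OF dE dH])
    also have "exp (p * ?l \<sigma>) * (D * (2 * pi * \<i> * ?z \<sigma>)) + exp (p * ?l \<sigma>) * (p * (2 * pi * \<i>)) * inc_beta p q (?z \<sigma>)
        = exp (p * ?l \<sigma>) * (2 * pi * \<i>) * (p * inc_beta p q (?z \<sigma>) + ?z \<sigma> * D)"
      by (simp add: algebra_simps)
    also have "\<dots> = exp ((p - 1) * zlog \<epsilon> 0 \<sigma> + (q - 1) * wlog \<epsilon> 0 \<sigma>) * reg_speed \<epsilon> 0 \<sigma>"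
      unfolding D(2) ep using nz by (simp add: powr_def zlog_def wlog_def reg_speed_def exp_add)
    finally show ?thesis .
  qed
  then have "((\<lambda>\<sigma>. exp ((p - 1) * zlog \<epsilon> 0 \<sigma> + (q - 1) * wlog \<epsilon> 0 \<sigma>) * reg_speed \<epsilon> 0 \<sigma>) has_integral
      exp (p * ?l 1) * inc_beta p q (?z 1) - exp (p * ?l 0) * inc_beta p q (?z 0)) {0..1}"
    by (intro fundamental_theorem_of_calculus) auto
  moreover have "exp (p * ?l 1) * inc_beta p q (?z 1) - exp (p * ?l 0) * inc_beta p q (?z 0)
      = (exp (2 * pi * \<i> * p) - 1) * (exp (p * of_real (ln \<epsilon>)) * inc_beta p q (of_real \<epsilon>))"
    by (simp add: exp_add algebra_simps exp_of_real)
  ultimately show ?thesis unfolding beta_cell_def by (simp add: integral_unique)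
qed

text \<open>The primitive z^p H also works on the real segment, and it vanishes at 0 because p > 0.
  Thus the improper integral equals the loop integral divided by e^(2 pi i p) - 1.\<close>

lemma beta_integral_near_0:
  fixes p q \<delta> :: real
  assumes p: "0 < p" "p < 1" and d: "0 < \<delta>" "\<delta> < 1"
  shows "((\<lambda>t. complex_of_real (t powr (p - 1) * (1 - t) powr (q - 1))) has_integral
      exp (of_real p * of_real (ln \<delta>)) * inc_beta (of_real p) (of_real q) (of_real \<delta>)) {0..\<delta>}"
proof -
  let ?F = "\<lambda>t. complex_of_real (t powr p) * inc_beta (of_real p) (of_real q) (of_real t)"
  have pZ: "complex_of_real p \<notin> \<int>"
  proof
    assume "complex_of_real p \<in> \<int>"
    then have "p \<in> \<int>" by simp
    then show False using p by (auto elim!: Ints_cases)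
  qed
  have deriv: "((\<lambda>t. inc_beta (of_real p) (of_real q) (of_real t)) has_vector_derivative D) (at t)"
    if "(inc_beta (of_real p) (of_real q) has_field_derivative D) (at (of_real t))" for D and t :: real
    using has_vector_derivative_real_field[OF that] .
  have "(?F has_vector_derivative complex_of_real (t powr (p - 1) * (1 - t) powr (q - 1))) (at t)"
    if t: "t \<in> {0<..<\<delta>}" for t
  proof -
    have t1: "norm (complex_of_real t) < 1" using t d by simp
    obtain D where D: "(inc_beta (of_real p) (of_real q) has_field_derivative D) (at (of_real t))"
      "of_real p * inc_beta (of_real p) (of_real q) (of_real t) + of_real t * D = (1 - of_real t) powr (of_real q - 1)"
      using inc_beta_deriv[OF pZ t1] by blast
    have e: "(1 - complex_of_real t) powr (of_real q - 1) = of_real ((1 - t) powr (q - 1))"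
      using powr_of_real[of "1 - t" "q - 1"] t d by simp
    have "((\<lambda>t. t powr p) has_real_derivative p * t powr (p - 1)) (at t)"
      using t by (auto intro!: derivative_eq_intros simp: powr_diff)
    then have "((\<lambda>t. complex_of_real (t powr p)) has_vector_derivative of_real (p * t powr (p - 1))) (at t)"
      by (intro has_vector_derivative_of_real) (simp add: has_real_derivative_iff_has_vector_derivative)
    from has_vector_derivative_mult[OF this deriv[OF D(1)]]
    have "(?F has_vector_derivative (of_real (t powr p) * D
       + of_real (p * t powr (p - 1)) * inc_beta (of_real p) (of_real q) (of_real t))) (at t)" .
    also have "of_real (t powr p) * D + of_real (p * t powr (p - 1)) * inc_beta (of_real p) (of_real q) (of_real t)
      = of_real (t powr (p - 1)) * (of_real p * inc_beta (of_real p) (of_real q) (of_real t) + of_real t * D)"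
      using t by (simp add: powr_diff field_simps)
    finally show ?thesis unfolding D(2) e by simp
  qed
  moreover have "continuous_on {0..\<delta>} ?F"
  proof -
    have "continuous_on {0..\<delta>} (\<lambda>t. t powr p)"
      using p by (intro continuous_on_powr') (auto intro!: continuous_intros)
    moreover have "continuous_on {0..\<delta>} (\<lambda>t. inc_beta (of_real p) (of_real q) (of_real t))"
    proof (rule continuous_at_imp_continuous_on, rule)
      fix t assume "t \<in> {0..\<delta>}"
      then have t1: "norm (complex_of_real t) < 1" using d by simp
      show "isCont (\<lambda>t. inc_beta (of_real p) (of_real q) (of_real t)) t"
        using inc_beta_deriv[OF pZ t1] deriv has_vector_derivative_continuous by metis
    qed
    ultimately show ?thesis by (intro continuous_on_mult continuous_on_of_real)
  qed
  \<comment> \<open>The integrand may blow up at 0, hence the form of the fundamental theorem that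
    asks for a derivative only in the open interval and for continuity on the closed one.\<close>
  ultimately have "((\<lambda>t. complex_of_real (t powr (p - 1) * (1 - t) powr (q - 1))) has_integral ?F \<delta> - ?F 0) {0..\<delta>}"
    using d by (intro fundamental_theorem_of_calculus_interior) auto
  moreover have "?F 0 = 0" using p by simp
  moreover have "complex_of_real (\<delta> powr p) = exp (of_real p * of_real (ln \<delta>))"
    using d by (simp add: powr_def exp_of_real flip: of_real_mult)
  ultimately show ?thesis by simp
qed

lemma beta_integral_near_1:
  fixes p q \<delta> :: real
  assumes q: "0 < q" "q < 1" and d: "0 < \<delta>" "\<delta> < 1"
  shows "((\<lambda>t. complex_of_real (t powr (p - 1) * (1 - t) powr (q - 1))) has_integral
      exp (of_real q * of_real (ln \<delta>)) * inc_beta (of_real q) (of_real p) (of_real \<delta>)) {1 - \<delta>..1}"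
proof -
  have im: "(\<lambda>x::real. 1 - x) ` {0..\<delta>} = {1 - \<delta>..1}"
    by (auto simp: image_iff intro!: bexI[of _ "1 - x" for x])
  from has_integral_affinity[OF beta_integral_near_0[OF q d, of p, folded cbox_interval], of "-1" 1]
  show ?thesis by (simp add: im mult.commute)
qed

lemma beta_cell_1_real:
  fixes p q :: real
  assumes e: "0 < \<epsilon>" "\<epsilon> < 1/2"
  shows "((\<lambda>t. complex_of_real (t powr (p - 1) * (1 - t) powr (q - 1))) has_integral
      beta_cell \<epsilon> 1 (of_real p) (of_real q)) {\<epsilon>..1 - \<epsilon>}"
proof -
  let ?f = "\<lambda>t. complex_of_real (t powr (p - 1) * (1 - t) powr (q - 1))"
  let ?g = "\<lambda>\<sigma>. \<epsilon> + (1 - 2 * \<epsilon>) * \<sigma>"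
  have c: "continuous_on {\<epsilon>..1 - \<epsilon>} ?f" using e by (auto intro!: continuous_intros)
  have "((\<lambda>\<sigma>. (1 - 2 * \<epsilon>) *\<^sub>R ?f (?g \<sigma>)) has_integral integral {?g 0..?g 1} ?f) {0..1}"
  proof (rule has_integral_substitution)
    show "?g ` {0..1} \<subseteq> {\<epsilon>..1 - \<epsilon>}" using segment_bounds[OF e] by auto
  qed (use e c in \<open>auto intro!: derivative_eq_intros\<close>)
  moreover have "(1 - 2 * \<epsilon>) *\<^sub>R ?f (?g \<sigma>) =
      exp ((of_real p - 1) * zlog \<epsilon> 1 \<sigma> + (of_real q - 1) * wlog \<epsilon> 1 \<sigma>) * reg_speed \<epsilon> 1 \<sigma>"
    if "\<sigma> \<in> {0..1}" for \<sigma>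
  proof -
    have pos: "0 < ?g \<sigma>" "0 < 1 - ?g \<sigma>" using segment_bounds[OF e that] e by simp_all
    have pow: "complex_of_real (y powr r) = exp (of_real r * of_real (ln y))" if "0 < y" for y r :: real
      using that by (simp add: powr_def exp_of_real flip: of_real_mult)
    show ?thesis
      unfolding of_real_mult pow[OF pos(1)] pow[OF pos(2)]
      by (simp add: zlog_def wlog_def reg_speed_def exp_add scaleR_conv_of_real)
  qed
  ultimately have "((\<lambda>\<sigma>. exp ((of_real p - 1) * zlog \<epsilon> 1 \<sigma> + (of_real q - 1) * wlog \<epsilon> 1 \<sigma>) * reg_speed \<epsilon> 1 \<sigma>)
      has_integral integral {?g 0..?g 1} ?f) {0..1}"
    by (rule has_integral_eq[rotated])
  then have "beta_cell \<epsilon> 1 (of_real p) (of_real q) = integral {\<epsilon>..1 - \<epsilon>} ?f"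
    unfolding beta_cell_def by (simp add: integral_unique)
  then show ?thesis using integrable_continuous_real[OF c] by (simp add: integrable_integral)
qed

section \<open>Collapsing the contour and analytic continuation in the exponents\<close>

lemma exp_2pi_eq_1_iff: "exp (2 * pi * \<i> * p) = 1 \<longleftrightarrow> p \<in> \<int>" for p :: complex
proof -
  have "exp (2 * pi * \<i> * p) = 1 \<longleftrightarrow> (\<exists>n::int. p = of_int n)"
    unfolding exp_eq_1[of "2 * pi * \<i> * p"] complex_eq_iff[of p] by (auto simp: mult.commute)
  then show ?thesis by (auto simp: Ints_def)
qed

text \<open>The coefficients reduce the two loops to the integrals over [0, \<epsilon>] and
  [1 - \<epsilon>, 1]; with the middle segment they add up to the classical Beta integral.\<close>

lemma reg_beta_real:
  fixes p q :: real
  assumes e: "0 < \<epsilon>" "\<epsilon> < 1/2" and p: "0 < p" "p < 1" and q: "0 < q" "q < 1"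
  shows "reg_beta \<epsilon> (of_real p) (of_real q) = Gamma (of_real p) * Gamma (of_real q) / Gamma (of_real p + of_real q)"
proof -
  let ?f = "\<lambda>t. complex_of_real (t powr (p - 1) * (1 - t) powr (q - 1))"
  have Z: "complex_of_real r \<notin> \<int>" if "0 < r" "r < 1" for r :: real
  proof
    assume "complex_of_real r \<in> \<int>"
    then have "r \<in> \<int>" by simp
    then show False using that by (auto elim!: Ints_cases)
  qed
  have ne: "exp (2 * pi * \<i> * p) - 1 \<noteq> 0" "exp (2 * pi * \<i> * q) - 1 \<noteq> 0"
    using exp_2pi_eq_1_iff[of p] exp_2pi_eq_1_iff[of q] Z[OF p] Z[OF q] by simp_all
  let ?P = "exp (of_real p * of_real (ln \<epsilon>)) * inc_beta (of_real p) (of_real q) (of_real \<epsilon>)"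
  let ?Q = "exp (of_real q * of_real (ln \<epsilon>)) * inc_beta (of_real q) (of_real p) (of_real \<epsilon>)"
  have 1: "(?f has_integral ?P) {0..\<epsilon>}" using beta_integral_near_0[OF p] e by simp
  have 2: "(?f has_integral beta_cell \<epsilon> 1 p q) {\<epsilon>..1 - \<epsilon>}" by (rule beta_cell_1_real[OF e])
  have 3: "(?f has_integral ?Q) {1 - \<epsilon>..1}" using beta_integral_near_1[OF q] e by simp
  have 12: "(?f has_integral ?P + beta_cell \<epsilon> 1 p q) {0..1 - \<epsilon>}"
    by (rule has_integral_combine[OF _ _ 1 2]) (use e in auto)
  have "(?f has_integral ?P + beta_cell \<epsilon> 1 p q + ?Q) {0..1}"
    by (rule has_integral_combine[OF _ _ 12 3]) (use e in auto)
  moreover have "(?f has_integral of_real (Beta p q)) {0..1}"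
    using has_integral_linear[OF has_integral_Beta_real[OF p(1) q(1)] bounded_linear_of_real]
    by (simp add: o_def)
  ultimately have "?P + beta_cell \<epsilon> 1 p q + ?Q = of_real (Beta p q)"
    by (rule has_integral_unique)
  moreover have "reg_beta \<epsilon> p q = ?P + beta_cell \<epsilon> 1 p q + ?Q"
    unfolding reg_beta_def beta_cell_2 using beta_cell_0[OF e Z[OF p], of q] beta_cell_0[OF e Z[OF q], of p] ne by simp
  ultimately show ?thesis using Beta_complex_of_real[of p q]
    by (simp only: Beta_def[of "complex_of_real p" "complex_of_real q"])
qed

lemma holomorphic_beta_cell:
  assumes e: "0 < \<epsilon>" "\<epsilon> < 1/2"
  shows "(\<lambda>p. beta_cell \<epsilon> c p q) holomorphic_on A"
    and "(\<lambda>q. beta_cell \<epsilon> c p q) holomorphic_on A"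
proof -
  have gen: "(\<lambda>w. integral {0..1} (\<lambda>\<sigma>. exp (w * L \<sigma>) * g \<sigma>)) holomorphic_on UNIV"
    if L: "continuous_on {0..1} L" and g: "continuous_on {0..1} g" for L g :: "real \<Rightarrow> complex"
    unfolding cbox_interval[symmetric]
  proof (rule leibniz_rule_holomorphic)
    show "((\<lambda>w. exp (w * L \<sigma>) * g \<sigma>) has_field_derivative exp (w * L \<sigma>) * L \<sigma> * g \<sigma>) (at w within UNIV)" for w \<sigma>
      by (auto intro!: derivative_eq_intros)
    show "(\<lambda>\<sigma>. exp (w * L \<sigma>) * g \<sigma>) integrable_on cbox 0 1" for w
      unfolding cbox_interval using L g
      by (intro integrable_continuous_real continuous_intros)
    have "continuous_on (UNIV \<times> cbox 0 1) (\<lambda>x. L (snd x))" "continuous_on (UNIV \<times> cbox 0 1) (\<lambda>x. g (snd x))"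
      using L g by (auto intro!: continuous_on_compose2[of "{0..1}" _ _ snd] continuous_intros)
    then show "continuous_on (UNIV \<times> cbox 0 1) (\<lambda>(w, \<sigma>). exp (w * L \<sigma>) * L \<sigma> * g \<sigma>)"
      unfolding case_prod_unfold by (intro continuous_intros)
  qed auto
  note cont = continuous_on_zlog[OF e, of c] continuous_on_wlog[OF e, of c] continuous_on_reg_speed[of _ \<epsilon> c]
  \<comment> \<open>The constant part of the exponent p - 1 is moved into the weight g, so that the
    parameter occurs only in \<open>exp (w * L \<sigma>)\<close>; the second half does the same for
    q.\<close>
  have "(\<lambda>p. beta_cell \<epsilon> c p q) holomorphic_on UNIV"
    using gen[of "zlog \<epsilon> c" "\<lambda>\<sigma>. exp ((q - 1) * wlog \<epsilon> c \<sigma> - zlog \<epsilon> c \<sigma>) * reg_speed \<epsilon> c \<sigma>"] cont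
    by (simp add: beta_cell_def mult.assoc[symmetric] exp_add[symmetric] algebra_simps continuous_intros)
  then show "(\<lambda>p. beta_cell \<epsilon> c p q) holomorphic_on A" by (rule holomorphic_on_subset) simp
  have "(\<lambda>q. beta_cell \<epsilon> c p q) holomorphic_on UNIV"
    using gen[of "wlog \<epsilon> c" "\<lambda>\<sigma>. exp ((p - 1) * zlog \<epsilon> c \<sigma> - wlog \<epsilon> c \<sigma>) * reg_speed \<epsilon> c \<sigma>"] cont
    by (simp add: beta_cell_def mult.assoc[symmetric] exp_add[symmetric] algebra_simps continuous_intros)
  then show "(\<lambda>q. beta_cell \<epsilon> c p q) holomorphic_on A" by (rule holomorphic_on_subset) simp
qed

text \<open>Removing a countable closed set leaves the plane open and connected, and 1/2 is an
  accumulation point of (0, 1) inside this domain; the identity theorem does the rest.\<close>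

lemma identity_from_unit_interval:
  assumes f: "f holomorphic_on - \<int>" and g: "g holomorphic_on - \<int>"
    and eq: "\<And>r::real. 0 < r \<Longrightarrow> r < 1 \<Longrightarrow> f (of_real r) = g (of_real r)" and z: "z \<notin> \<int>"
  shows "f z = g z"
proof -
  have op: "open (- \<int> :: complex set)" by (simp add: open_Compl)
  have con: "connected (- \<int> :: complex set)"
    using connected_open_diff_countable[of "UNIV :: complex set" \<int>]
    by (simp add: Compl_eq_Diff_UNIV countable_int connected_UNIV)
  let ?U = "complex_of_real ` {0<..<1}"
  have sub: "?U \<subseteq> - \<int>"
  proof clarify
    fix r :: real assume "r \<in> {0<..<1}" "complex_of_real r \<in> \<int>"
    then have "r \<in> \<int>" "0 < r" "r < 1" by auto
    then show False by (auto elim!: Ints_cases)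
  qed
  have half: "complex_of_real (1/2) \<in> - \<int>" using sub by force
  have lim: "complex_of_real (1/2) islimpt ?U"
  proof (rule islimpt_isCont_image)
    show "(1/2::real) islimpt {0<..<1}" by (rule islimpt_greaterThanLessThan1[THEN islimpt_subset, of "1/2" 1]) auto
    show "eventually (\<lambda>y. complex_of_real y \<noteq> complex_of_real (1/2)) (at (1/2))"
      by (simp only: of_real_eq_iff) (simp add: eventually_at_filter)
  qed auto
  have "f z - g z = 0"
    by (rule analytic_continuation[OF _ op con sub half lim, of "\<lambda>z. f z - g z"])
       (use f g eq z in \<open>auto intro!: holomorphic_intros\<close>)
  then show ?thesis by simp
qed

theorem reg_beta_eq:
  assumes e: "0 < \<epsilon>" "\<epsilon> < 1/2" and p: "p \<notin> \<int>" and q: "q \<notin> \<int>"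
  shows "reg_beta \<epsilon> p q = Gamma p * Gamma q / Gamma (p + q)"
proof -
  \<comment> \<open>\<open>rGamma\<close> is entire, so this form of the right-hand side needs no
    restriction on p + q. Where p + q is a pole of Gamma, both it and the quotient in the claim are
    0.\<close>
  let ?G = "\<lambda>p q. Gamma p * Gamma q * rGamma (p + q :: complex)"
  have ne: "exp (2 * complex_of_real pi * \<i> * p) - 1 \<noteq> 0" if "p \<notin> \<int>" for p
    using exp_2pi_eq_1_iff[of p] that by simp
  have nonpos: "- \<int> \<inter> \<int>\<^sub>\<le>\<^sub>0 = ({} :: complex set)" using nonpos_Ints_subset_Ints by blast
  have 1: "reg_beta \<epsilon> p (of_real r) = ?G p (of_real r)" if r: "0 < r" "r < 1" and p: "p \<notin> \<int>" for p and r :: real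
  proof (rule identity_from_unit_interval[OF _ _ _ p])
    show "(\<lambda>p. reg_beta \<epsilon> p (of_real r)) holomorphic_on - \<int>"
      unfolding reg_beta_def using ne
      by (auto intro!: holomorphic_intros holomorphic_beta_cell[OF e])
    show "(\<lambda>p. ?G p (of_real r)) holomorphic_on - \<int>"
      using nonpos by (auto intro!: holomorphic_intros holomorphic_on_compose[of _ _ rGamma, unfolded o_def])
    show "reg_beta \<epsilon> (of_real s) (of_real r) = ?G (of_real s) (of_real r)" if "0 < s" "s < 1" for s :: real
      using reg_beta_real[OF e that r] by (simp add: rGamma_inverse_Gamma divide_inverse)
  qed
  \<comment> \<open>The continuation is done one variable at a time: p has become an arbitrary
    non-integer for real q in (0, 1), and now q follows with p fixed.\<close>
  have "reg_beta \<epsilon> p q = ?G p q"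
  proof (rule identity_from_unit_interval[OF _ _ _ q])
    show "(\<lambda>q. reg_beta \<epsilon> p q) holomorphic_on - \<int>"
      unfolding reg_beta_def using ne
      by (auto intro!: holomorphic_intros holomorphic_beta_cell[OF e])
    show "(\<lambda>q. ?G p q) holomorphic_on - \<int>"
      using nonpos by (auto intro!: holomorphic_intros holomorphic_on_compose[of _ _ rGamma, unfolded o_def])
  qed (use 1 p in auto)
  then show ?thesis by (simp add: rGamma_inverse_Gamma divide_inverse)
qed

section \<open>Termwise integration over the cells\<close>

abbreviation unit_cube_measure :: "nat \<Rightarrow> (nat \<Rightarrow> real) measure" where
  "unit_cube_measure m \<equiv> PiM {1..m} (\<lambda>_. lebesgue_on {0..1::real})"

interpretation unit_cube: product_sigma_finite "\<lambda>_::nat. lebesgue_on {0..1::real}"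
proof
  interpret finite_measure "lebesgue_on {0..1::real}"
    by (rule finite_measure_lebesgue_on) simp
  show "\<exists>A. countable A \<and> A \<subseteq> sets (lebesgue_on {0..1::real}) \<and> \<Union> A = space (lebesgue_on {0..1}) \<and>
      (\<forall>a\<in>A. emeasure (lebesgue_on {0..1}) a \<noteq> \<infinity>)"
    by (rule sigma_finite_countable)
qed

definition cell_factor :: "real \<Rightarrow> nat \<Rightarrow> complex \<Rightarrow> complex \<Rightarrow> real \<Rightarrow> complex" where
  "cell_factor \<epsilon> c p q \<sigma> = exp ((p - 1) * zlog \<epsilon> c \<sigma> + (q - 1) * wlog \<epsilon> c \<sigma>) * reg_speed \<epsilon> c \<sigma>"

lemma continuous_on_cell_factor:
  assumes "0 < \<epsilon>" "\<epsilon> < 1/2"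
  shows "continuous_on {0..1} (cell_factor \<epsilon> c p q)"
  unfolding cell_factor_def
  by (intro continuous_intros continuous_on_zlog continuous_on_wlog continuous_on_reg_speed assms)

lemma integrable_cell_factor:
  assumes "0 < \<epsilon>" "\<epsilon> < 1/2"
  shows "integrable (lebesgue_on {0..1}) (cell_factor \<epsilon> c p q)"
  by (intro continuous_imp_integrable_real continuous_on_cell_factor assms)

lemma integral_cell_factor:
  assumes "0 < \<epsilon>" "\<epsilon> < 1/2"
  shows "integral\<^sup>L (lebesgue_on {0..1}) (cell_factor \<epsilon> c p q) = beta_cell \<epsilon> c p q"
  using lebesgue_integral_eq_integral[OF integrable_cell_factor[OF assms], of c p q]
  by (simp add: beta_cell_def cell_factor_def[abs_def])

text \<open>All three pieces of the contour lie in the annulus \<epsilon> \<le> |z| \<le> 1 +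
  \<epsilon>; the two values bound z and 1/z there. Only g = 1 and g = -1 occur.\<close>

definition zbound :: "real \<Rightarrow> complex \<Rightarrow> real" where
  "zbound \<epsilon> g = (if g = 1 then 1 + \<epsilon> else 1 / \<epsilon>)"

lemma norm_exp_zlog_le:
  assumes e: "0 < \<epsilon>" "\<epsilon> < 1/2" and s: "\<sigma> \<in> {0..1}" and g: "g = 1 \<or> g = -1"
  shows "norm (exp (g * zlog \<epsilon> c \<sigma>)) \<le> zbound \<epsilon> g"
proof -
  let ?z = "complex_of_real \<epsilon> * exp (2 * pi * \<i> * complex_of_real \<sigma>)"
  have n: "norm ?z = \<epsilon>" by (rule norm_circle[OF e(1)])
  have 1: "norm (1 - ?z) \<le> 1 + \<epsilon>" using norm_triangle_ineq4[of 1 ?z] n by simp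
  have 2: "norm (1 - ?z) \<ge> \<epsilon>" using norm_triangle_ineq2[of 1 ?z] n e by simp
  note b = segment_bounds[OF e s]
  have "\<epsilon> \<le> norm (reg_path \<epsilon> c \<sigma>) \<and> norm (reg_path \<epsilon> c \<sigma>) \<le> 1 + \<epsilon>"
    using 1 2 n b e by (auto simp: reg_path_def simp del: of_real_add of_real_mult of_real_diff)
  then have r: "\<epsilon> \<le> norm (exp (zlog \<epsilon> c \<sigma>))" "norm (exp (zlog \<epsilon> c \<sigma>)) \<le> 1 + \<epsilon>"
    unfolding exp_zlog[OF e s] by auto
  show ?thesis
  proof (cases "g = 1")
    case True then show ?thesis using r by (simp add: zbound_def)
  next
    case False
    then have "g = -1" using g by simp
    moreover have "inverse (norm (exp (zlog \<epsilon> c \<sigma>))) \<le> inverse \<epsilon>"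
      using r(1) e by (intro le_imp_inverse_le) auto
    ultimately show ?thesis using False
      by (simp add: zbound_def exp_minus norm_inverse norm_divide inverse_eq_divide del: norm_exp_eq_Re)
  qed
qed

text \<open>The monomial Q for every k at once: g j is the exponent of z_j. Writing powers through
  \<open>zlog\<close> lets them merge with the exponents in \<open>cell_factor\<close>.\<close>

definition cell_arg :: "nat \<Rightarrow> real \<Rightarrow> (nat \<Rightarrow> complex) \<Rightarrow> real \<Rightarrow> (nat \<Rightarrow> nat) \<Rightarrow> (nat \<Rightarrow> real) \<Rightarrow> complex" where
  "cell_arg m x g \<epsilon> c s = of_real x * (\<Prod>j=1..m. exp (g j * zlog \<epsilon> (c j) (s j)))"

lemma norm_cell_arg_le:
  assumes e: "0 < \<epsilon>" "\<epsilon> < 1/2" and g: "\<And>j. g j = 1 \<or> g j = -1" and x: "0 < x"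
    and s: "\<And>j. j \<in> {1..m} \<Longrightarrow> s j \<in> {0..1}"
  shows "norm (cell_arg m x g \<epsilon> c s) \<le> x * (\<Prod>j=1..m. zbound \<epsilon> (g j))"
  unfolding cell_arg_def norm_mult prod_norm[symmetric] using x
  by (auto intro!: mult_left_mono prod_mono norm_exp_zlog_le e g s simp del: atLeastAtMost_iff norm_exp_eq_Re)

text \<open>Multiplication by Q^n merely replaces p_j by p_j + g_j n, so each term of the binomial
  series is again a product of one-variable integrands and Fubini applies.\<close>

lemma cell_integral_sums:
  assumes e: "0 < \<epsilon>" "\<epsilon> < 1/2" and g: "\<And>j. g j = 1 \<or> g j = -1" and x: "0 < x"
    and small: "x * (\<Prod>j=1..m. zbound \<epsilon> (g j)) < 1"
  shows "(\<lambda>n. ((- \<alpha> gchoose n) * (-1) ^ n * of_real x ^ n) *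
             (\<Prod>j=1..m. beta_cell \<epsilon> (c j) (p j + g j * of_nat n) (q j)))
    sums integral\<^sup>L (unit_cube_measure m)
      (\<lambda>s. (\<Prod>j=1..m. cell_factor \<epsilon> (c j) (p j) (q j) (s j)) * exp (- \<alpha> * Ln (1 - cell_arg m x g \<epsilon> c s)))"
    (is "?lhs sums integral\<^sup>L _ ?F")
proof -
  let ?M = "unit_cube_measure m"
  let ?A = "\<lambda>n. (- \<alpha> gchoose n) * (-1) ^ n * of_real x ^ n"
  let ?B = "\<lambda>j. zbound \<epsilon> (g j)"
  let ?f = "\<lambda>n j. cell_factor \<epsilon> (c j) (p j + g j * of_nat n) (q j)"
  define f where "f n s = ?A n * (\<Prod>j=1..m. ?f n j (s j))" for n s
  have B0: "0 \<le> ?B j" for j using e by (simp add: zbound_def)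
  have sp: "s j \<in> {0..1}" if "s \<in> space ?M" "j \<in> {1..m}" for s j
    using that by (auto simp: space_PiM PiE_def Pi_def)
  have split: "?f n j \<sigma> = cell_factor \<epsilon> (c j) (p j) (q j) \<sigma> * exp (g j * zlog \<epsilon> (c j) \<sigma>) ^ n" for n j \<sigma>
    by (simp add: cell_factor_def exp_of_nat_mult[symmetric] exp_add[symmetric] algebra_simps flip: exp_add)
  have int: "integrable ?M (f n)" for n
    unfolding f_def
    by (intro integrable_mult_right unit_cube.product_integrable_prod integrable_cell_factor e) simp
  have f_int: "integral\<^sup>L ?M (f n) = ?lhs n" for n
    unfolding f_def
    by (subst integral_mult_right_zero, subst unit_cube.product_integral_prod)
      (simp_all add: integrable_cell_factor[OF e] integral_cell_factor[OF e])
  have f_sums: "(\<lambda>n. f n s) sums ?F s" and f_abs: "summable (\<lambda>n. norm (f n s))" if s: "s \<in> space ?M" for s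
  proof -
    let ?Q = "cell_arg m x g \<epsilon> c s" and ?P = "\<Prod>j=1..m. cell_factor \<epsilon> (c j) (p j) (q j) (s j)"
    have Q: "norm ?Q < 1"
      by (rule le_less_trans[OF norm_cell_arg_le[OF e g x sp[OF s]] small])
    have eq: "f n s = ?P * ((- \<alpha> gchoose n) * (-1) ^ n * ?Q ^ n)" for n
      unfolding f_def split cell_arg_def by (simp add: prod.distrib power_mult_distrib prod_power_distrib)
    have "1 - ?Q \<noteq> 0" using Q by auto
    then have "(1 - ?Q) powr (- \<alpha>) = exp (- \<alpha> * Ln (1 - ?Q))" by (simp add: powr_def)
    then show "(\<lambda>n. f n s) sums ?F s"
      unfolding eq using sums_mult[OF one_minus_powr_sums[OF Q, of "- \<alpha>"], of ?P] by simp
    show "summable (\<lambda>n. norm (f n s))"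
      unfolding eq norm_mult[of ?P] by (intro summable_mult summable_norm_one_minus_powr Q)
  qed
  have s_int: "summable (\<lambda>n. \<integral>s. norm (f n s) \<partial>?M)"
  proof -
    let ?N = "\<lambda>j. integral\<^sup>L (lebesgue_on {0..1}) (\<lambda>\<sigma>. norm (cell_factor \<epsilon> (c j) (p j) (q j) \<sigma>))"
    have le: "integral\<^sup>L (lebesgue_on {0..1}) (\<lambda>\<sigma>. norm (?f n j \<sigma>)) \<le> ?N j * ?B j ^ n" for n j
    proof -
      have "integral\<^sup>L (lebesgue_on {0..1}) (\<lambda>\<sigma>. norm (?f n j \<sigma>))
          \<le> integral\<^sup>L (lebesgue_on {0..1}) (\<lambda>\<sigma>. norm (cell_factor \<epsilon> (c j) (p j) (q j) \<sigma>) * ?B j ^ n)"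
      proof (rule integral_mono)
        fix \<sigma> assume "\<sigma> \<in> space (lebesgue_on {0..1::real})"
        then have "\<sigma> \<in> {0..1}" by simp
        then show "norm (?f n j \<sigma>) \<le> norm (cell_factor \<epsilon> (c j) (p j) (q j) \<sigma>) * ?B j ^ n"
          unfolding split norm_mult norm_power
          by (intro mult_left_mono power_mono norm_exp_zlog_le e g) auto
      qed (intro integrable_norm integrable_mult_left integrable_cell_factor e)+
      then show ?thesis by simp
    qed
    \<comment> \<open>Domination: replacing every |z_j^(g_j)| by its bound gives a constant times
      the binomial series at the real point x times the product of the bounds, which
      \<open>small\<close> puts below 1.\<close>
    have "norm (\<integral>s. norm (f n s) \<partial>?M) \<le> norm ((- \<alpha> gchoose n) * (-1) ^ n * complex_of_real (x * (\<Prod>j=1..m. ?B j)) ^ n) * (\<Prod>j=1..m. ?N j)" for n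
    proof -
      have "(\<integral>s. norm (f n s) \<partial>?M) = norm (?A n) * (\<Prod>j=1..m. integral\<^sup>L (lebesgue_on {0..1}) (\<lambda>\<sigma>. norm (?f n j \<sigma>)))"
        unfolding f_def norm_mult[of "?A n"] prod_norm[symmetric]
        by (subst integral_mult_right_zero, subst unit_cube.product_integral_prod)
          (simp_all add: integrable_norm integrable_cell_factor[OF e])
      also have "\<dots> \<le> norm (?A n) * (\<Prod>j=1..m. ?N j * ?B j ^ n)"
        by (intro mult_left_mono prod_mono conjI le integral_nonneg_AE) auto
      also have "\<dots> = norm ((- \<alpha> gchoose n) * (-1) ^ n * complex_of_real (x * (\<Prod>j=1..m. ?B j)) ^ n) * (\<Prod>j=1..m. ?N j)"
        using x B0 prod_nonneg[of "{1..m}" ?B]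
        by (simp add: norm_mult norm_power prod.distrib power_mult_distrib prod_power_distrib abs_mult abs_prod
            prod_norm[symmetric])
      finally show ?thesis by (simp add: integral_nonneg_AE)
    qed
    moreover have "summable (\<lambda>n. norm ((- \<alpha> gchoose n) * (-1) ^ n * complex_of_real (x * (\<Prod>j=1..m. ?B j)) ^ n) * (\<Prod>j=1..m. ?N j))"
      using x B0 small prod_nonneg[of "{1..m}" ?B]
      by (intro summable_mult2 summable_norm_one_minus_powr) (simp only: norm_of_real abs_of_nonneg mult_nonneg_nonneg less_imp_le)
    ultimately show ?thesis by (rule summable_comparison_test'[rotated])
  qed
  have ae: "AE s in ?M. summable (\<lambda>n. norm (f n s))" using f_abs by (intro AE_I2)
  have "(\<lambda>n. integral\<^sup>L ?M (f n)) sums (\<integral>s. (\<Sum>n. f n s) \<partial>?M)"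
    by (rule sums_integral[OF int ae s_int])
  also have "(\<integral>s. (\<Sum>n. f n s) \<partial>?M) = integral\<^sup>L ?M ?F"
    using f_sums by (intro Bochner_Integration.integral_cong refl) (auto simp: sums_iff)
  finally show ?thesis unfolding f_int .
qed

text \<open>This periodicity allows one fixed set of regularizing coefficients for all terms of the
  series.\<close>

lemma exp_2pi_shift:
  fixes p d :: complex
  assumes "d \<in> \<int>"
  shows "exp (2 * pi * \<i> * (p + d)) = exp (2 * pi * \<i> * p)"
  using exp_2pi_eq_1_iff[of d] assms by (simp add: distrib_left exp_add)

text \<open>For fixed n the sum over the 3^m cells expands a product of m sums with three terms
  each, and every such sum is a \<open>reg_beta\<close> with shifted first parameter.\<close>

lemma regularized_sums:
  assumes e: "0 < \<epsilon>" "\<epsilon> < 1/2" and g: "\<And>j. g j = 1 \<or> g j = -1" and x: "0 < x"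
    and small: "x * (\<Prod>j=1..m. zbound \<epsilon> (g j)) < 1"
    and p: "\<And>j. j \<in> {1..m} \<Longrightarrow> p j \<notin> \<int>" and q: "\<And>j. j \<in> {1..m} \<Longrightarrow> q j \<notin> \<int>"
    and C0: "\<And>j. j \<in> {1..m} \<Longrightarrow> C j 0 = 1 / (exp (2 * pi * \<i> * p j) - 1)"
    and C1: "\<And>j. j \<in> {1..m} \<Longrightarrow> C j 1 = 1"
    and C2: "\<And>j. j \<in> {1..m} \<Longrightarrow> C j 2 = - 1 / (exp (2 * pi * \<i> * q j) - 1)"
  shows "(\<lambda>n. ((- \<alpha> gchoose n) * (-1) ^ n * of_real x ^ n) *
      (\<Prod>j=1..m. Gamma (p j + g j * of_nat n) * Gamma (q j) / Gamma (p j + g j * of_nat n + q j)))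
    sums (\<Sum>c\<in>PiE {1..m} (\<lambda>_. {0,1,2::nat}). (\<Prod>j=1..m. C j (c j)) *
      integral\<^sup>L (unit_cube_measure m)
      (\<lambda>s. (\<Prod>j=1..m. cell_factor \<epsilon> (c j) (p j) (q j) (s j)) * exp (- \<alpha> * Ln (1 - cell_arg m x g \<epsilon> c s))))"
proof -
  let ?A = "\<lambda>n. (- \<alpha> gchoose n) * (-1) ^ n * complex_of_real x ^ n"
  let ?Bc = "\<lambda>n j. \<lambda>c. beta_cell \<epsilon> c (p j + g j * of_nat n) (q j)"
  have int: "g j * of_nat n \<in> \<int>" for j n using g[of j] by auto
  have one: "(\<Sum>c\<in>{0,1,2}. C j c * ?Bc n j c) =
      Gamma (p j + g j * of_nat n) * Gamma (q j) / Gamma (p j + g j * of_nat n + q j)" if j: "j \<in> {1..m}" for n j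
  proof -
    have pn: "p j + g j * of_nat n \<notin> \<int>"
    proof
      assume "p j + g j * of_nat n \<in> \<int>"
      from Ints_diff[OF this int[of j n]] show False using p[OF j] by simp
    qed
    have "(\<Sum>c\<in>{0,1,2}. C j c * ?Bc n j c) = reg_beta \<epsilon> (p j + g j * of_nat n) (q j)"
      unfolding reg_beta_def exp_2pi_shift[OF int]
      using C0[OF j] C1[OF j] C2[OF j] by simp
    then show ?thesis using reg_beta_eq[OF e pn q[OF j]] by simp
  qed
  have "(\<lambda>n. \<Sum>c\<in>PiE {1..m} (\<lambda>_. {0,1,2::nat}). (\<Prod>j=1..m. C j (c j)) * (?A n * (\<Prod>j=1..m. ?Bc n j (c j))))
    sums (\<Sum>c\<in>PiE {1..m} (\<lambda>_. {0,1,2::nat}). (\<Prod>j=1..m. C j (c j)) *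
      integral\<^sup>L (unit_cube_measure m)
      (\<lambda>s. (\<Prod>j=1..m. cell_factor \<epsilon> (c j) (p j) (q j) (s j)) * exp (- \<alpha> * Ln (1 - cell_arg m x g \<epsilon> c s))))"
    by (intro sums_sum sums_mult cell_integral_sums e g x small)
  also have "(\<lambda>n. \<Sum>c\<in>PiE {1..m} (\<lambda>_. {0,1,2::nat}). (\<Prod>j=1..m. C j (c j)) * (?A n * (\<Prod>j=1..m. ?Bc n j (c j))))
    = (\<lambda>n. ?A n * (\<Prod>j=1..m. Gamma (p j + g j * of_nat n) * Gamma (q j) / Gamma (p j + g j * of_nat n + q j)))"
  proof
    fix n
    have "(\<Sum>c\<in>PiE {1..m} (\<lambda>_. {0,1,2::nat}). (\<Prod>j=1..m. C j (c j)) * (?A n * (\<Prod>j=1..m. ?Bc n j (c j))))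
      = ?A n * (\<Sum>c\<in>PiE {1..m} (\<lambda>_. {0,1,2::nat}). \<Prod>j=1..m. C j (c j) * ?Bc n j (c j))"
      by (simp add: sum_distrib_left prod.distrib mult_ac)
    also have "(\<Sum>c\<in>PiE {1..m} (\<lambda>_. {0,1,2::nat}). \<Prod>j=1..m. C j (c j) * ?Bc n j (c j))
      = (\<Prod>j=1..m. \<Sum>c\<in>{0,1,2}. C j c * ?Bc n j c)"
      by (rule prod_sum_PiE[symmetric]) auto
    also have "\<dots> = (\<Prod>j=1..m. Gamma (p j + g j * of_nat n) * Gamma (q j) / Gamma (p j + g j * of_nat n + q j))"
      by (intro prod.cong refl one)
    finally show "(\<Sum>c\<in>PiE {1..m} (\<lambda>_. {0,1,2::nat}). (\<Prod>j=1..m. C j (c j)) * (?A n * (\<Prod>j=1..m. ?Bc n j (c j))))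
      = ?A n * (\<Prod>j=1..m. Gamma (p j + g j * of_nat n) * Gamma (q j) / Gamma (p j + g j * of_nat n + q j))" .
  qed
  finally show ?thesis .
qed

section \<open>Continuous logarithms on the cube\<close>

lemma connected_pcube: "connected (pcube m)"
proof -
  \<comment> \<open>Extensional functions become a full product by adding the singleton
    \<open>{undefined}\<close> as factor at every index outside 1..m; products of connected sets are
    connected.\<close>
  have "pcube m = (PiE UNIV (\<lambda>i. if i \<in> {1..m} then {0..1} else {undefined}) :: (nat \<Rightarrow> real) set)"
    by (auto simp: pcube_def PiE_def Pi_def extensional_def split: if_splits) 
  moreover have "connectedin euclidean (PiE UNIV (\<lambda>i. if i \<in> {1..m} then {0..1::real} else {undefined}))"
    unfolding euclidean_product_topology[symmetric] connectedin_PiE by auto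
  ultimately show ?thesis by (simp only: connectedin_iff_connected)
qed

lemma pbase_in_pcube: "pbase m \<in> pcube m"
  by (auto simp: pbase_def pcube_def)

lemma continuous_on_pcube_coord:
  assumes "continuous_on {0..1} f" "j \<in> {1..m}"
  shows "continuous_on (pcube m) (\<lambda>s. f (s j))"
  by (rule continuous_on_compose2[OF assms(1)])
     (use assms(2) in \<open>auto intro!: continuous_on_product_then_coordinatewise continuous_on_id simp: pcube_def PiE_def Pi_def\<close>)

text \<open>Two continuous logarithms of g differ by 2 pi i times a continuous integer-valued
  function. It is constant on the connected cube and 0 at the base point, so any explicit candidate
  computes the definite description.\<close>

lemma cont_log_eq:
  assumes L: "continuous_on (pcube m) L" "\<And>y. y \<in> pcube m \<Longrightarrow> exp (L y) = g y" "L (pbase m) = l0"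
    and s: "s \<in> pcube m"
  shows "cont_log (pcube m) (pbase m) g l0 s = L s"
  unfolding cont_log_def
proof (rule the_equality)
  show "\<exists>L'. continuous_on (pcube m) L' \<and> (\<forall>y\<in>pcube m. exp (L' y) = g y) \<and> L' (pbase m) = l0 \<and> L' s = L s"
    using L by blast
  fix v assume "\<exists>L'. continuous_on (pcube m) L' \<and> (\<forall>y\<in>pcube m. exp (L' y) = g y) \<and> L' (pbase m) = l0 \<and> L' s = v"
  then obtain L' where L': "continuous_on (pcube m) L'" "\<And>y. y \<in> pcube m \<Longrightarrow> exp (L' y) = g y"
    "L' (pbase m) = l0" "L' s = v" by blast
  define h where "h y = Im (L' y - L y) / (2 * pi)" for y
  have *: "\<exists>n::int. L' y - L y = 2 * complex_of_int n * complex_of_real pi * \<i>" if "y \<in> pcube m" for y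
  proof -
    have "exp (L' y - L y) = 1" using L(2) L'(2) that by (simp add: exp_diff) (metis exp_not_eq_zero right_inverse_eq)
    then obtain n :: int where "Re (L' y - L y) = 0" "Im (L' y - L y) = of_int (2 * n) * pi"
      unfolding exp_eq_1 by blast
    then show ?thesis by (intro exI[of _ n]) (simp add: complex_eq_iff)
  qed
  have hint: "h y \<in> \<int>" if y: "y \<in> pcube m" for y
  proof -
    obtain n :: int where "L' y - L y = 2 * complex_of_int n * complex_of_real pi * \<i>" using *[OF y] by blast
    then show ?thesis by (simp add: h_def del: minus_complex.sel)
  qed
  have hc: "continuous_on (pcube m) h"
    unfolding h_def by (intro continuous_intros L L') auto
  have "h constant_on pcube m"
  proof (rule continuous_discrete_range_constant[OF connected_pcube hc])
    fix y assume y: "y \<in> pcube m"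
    show "\<exists>e>0. \<forall>z. z \<in> pcube m \<and> h z \<noteq> h y \<longrightarrow> e \<le> norm (h z - h y)"
    proof (intro exI[of _ 1] conjI allI impI)
      fix z assume z: "z \<in> pcube m \<and> h z \<noteq> h y"
      then have "h z - h y \<in> \<int>" "h z - h y \<noteq> 0" using hint y by auto
      then show "1 \<le> norm (h z - h y)" using Ints_nonzero_abs_ge1 by fastforce
    qed simp
  qed
  then have "h s = h (pbase m)" unfolding constant_on_def using s pbase_in_pcube by metis
  then have "h s = 0" using L' L by (simp add: h_def)
  then have "L' s - L s = 0" using *[OF s] by (auto simp: h_def complex_eq_iff)
  then show "v = L s" using L' by simp
qed

section \<open>The Jacobian determinant\<close>

text \<open>The only permutation contributing to the determinant of \<open>iexp k\<close> for \<open>0 < k\<close> is \<open>cyc k m\<close>.\<close>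
definition cyc :: "nat \<Rightarrow> nat \<Rightarrow> nat \<Rightarrow> nat" where
  "cyc r m i = (if i < r \<or> m < i then i else if i = m then r else Suc i)"

text \<open>Lengthening the cycle by one index composes it with the transposition of r and the new
  last index, which flips the sign.\<close>

lemma cyc_permutes: "r \<le> m \<Longrightarrow> cyc r m permutes {r..m} \<and> sign (cyc r m) = (-1) ^ (m - r)"
proof (induction rule: dec_induct)
  case base
  have "cyc r r = id" by (auto simp: cyc_def fun_eq_iff)
  then show ?case by (simp only: permutes_id sign_id) simp
next
  case (step n)
  have eq: "cyc r (Suc n) = Transposition.transpose r (Suc n) \<circ> cyc r n"
    using step(1) by (auto simp: cyc_def Transposition.transpose_def fun_eq_iff)
  have p: "cyc r n permutes {r..Suc n}"
    using step by (auto intro: permutes_subset)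
  have "Transposition.transpose r (Suc n) permutes {r..Suc n}"
    using step(1) by (auto intro: permutes_swap_id)
  then have perm: "cyc r (Suc n) permutes {r..Suc n}"
    unfolding eq using p by (rule permutes_compose[rotated])
  have "sign (cyc r (Suc n)) = sign (Transposition.transpose r (Suc n)) * sign (cyc r n)"
    unfolding eq using p permutation_permutes permutation_swap_id by (intro sign_compose) (auto intro: permutation_swap_id)
  then show ?case using perm step by (simp add: sign_swap_id Suc_diff_le)
qed

text \<open>For a monomial map the Jacobian entry is t_i times an exponent times the logarithmic
  derivative of z_j; this separates the row and column factors from the constant exponent
  matrix.\<close>

lemma detn_scale:
  "detn m (\<lambda>i j. R i * A i j * C j) = (\<Prod>i=1..m. R i) * (\<Prod>j=1..m. C j) * detn m A"
proof -
  have "(\<Prod>i=1..m. R i * A i (p i) * C (p i)) = (\<Prod>i=1..m. R i) * (\<Prod>j=1..m. C j) * (\<Prod>i=1..m. A i (p i))"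
    if "p permutes {1..m}" for p
    using prod.permute[OF that, of C] by (simp add: prod.distrib o_def)
  then show ?thesis unfolding detn_def
    by (simp add: sum_distrib_left mult.assoc mult.left_commute)
qed

lemma detn_single:
  assumes "p permutes {1..m}"
    and "\<And>p'. p' permutes {1..m} \<Longrightarrow> (\<And>i. i \<in> {1..m} \<Longrightarrow> A i (p' i) \<noteq> 0) \<Longrightarrow> p' = p"
  shows "detn m A = of_int (sign p) * (\<Prod>i=1..m. A i (p i))"
proof -
  have "of_int (sign p') * (\<Prod>i=1..m. A i (p' i)) = 0" if "p' permutes {1..m}" "p' \<noteq> p" for p'
    using assms(2)[OF that(1)] that(2) by (auto simp: prod_zero_iff)
  then have "detn m A = (\<Sum>p'\<in>{p}. of_int (sign p') * (\<Prod>i=1..m. A i (p' i)))"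
    unfolding detn_def using assms(1)
    by (intro sum.mono_neutral_right) (auto simp: finite_permutations)
  then show ?thesis by simp
qed

text \<open>The exponent matrix of \<open>iota_k\<close>: \<open>t\<^sub>i\<close> is a constant times \<open>\<Prod>\<^sub>j z\<^sub>j\<close> to the power \<open>iexp k i j\<close>.\<close>
definition iexp :: "nat \<Rightarrow> nat \<Rightarrow> nat \<Rightarrow> complex" where
  "iexp k i j = (if k = 0 \<or> i < k then (if j \<le> i then 1 else 0)
                 else if j = k then 1 else if i < j then - 1 else 0)"

lemma detn_iexp:
  assumes "k \<le> m" "1 \<le> m"
  shows "detn m (iexp k) = 1"
proof (cases "k = 0")
  case True
  have "detn m (iexp k) = of_int (sign (id :: nat \<Rightarrow> nat)) * (\<Prod>i=1..m. iexp k i (id i))"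
  proof (rule detn_single[OF permutes_id])
    fix p' assume p': "p' permutes {1..m}" "\<And>i. i \<in> {1..m} \<Longrightarrow> iexp k i (p' i) \<noteq> 0"
    have "p' i \<le> i" if "i \<in> {1..m}" for i
      using p'(2)[OF that] True by (simp add: iexp_def split: if_splits)
    then have "\<forall>i\<in>{1..m}. p' i \<le> i" by blast
    then show "p' = id" using permutes_natset_le p'(1) by blast
  qed
  then show ?thesis using True by (simp add: iexp_def)
next
  case False
  have cp: "cyc k m permutes {1..m}" "sign (cyc k m) = (-1) ^ (m - k)"
    using cyc_permutes[OF assms(1)] False by (auto intro: permutes_subset)
  have "detn m (iexp k) = of_int (sign (cyc k m)) * (\<Prod>i=1..m. iexp k i (cyc k m i))"
  proof (rule detn_single[OF cp(1)])
    fix p' assume p': "p' permutes {1..m}" "\<And>i. i \<in> {1..m} \<Longrightarrow> iexp k i (p' i) \<noteq> 0"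
    have low: "p' i \<le> i" if "i \<in> {1..m}" "i < k" for i
      using p'(2)[OF that(1)] that False by (auto simp: iexp_def split: if_splits)
    have high: "p' i = k \<or> i < p' i" if "i \<in> {1..m}" "k \<le> i" for i
      using p'(2)[OF that(1)] that False by (auto simp: iexp_def split: if_splits)
    have im: "p' i \<in> {1..m}" if "i \<in> {1..m}" for i using p'(1) that permutes_in_image by metis
    have inj: "p' i = p' j \<longleftrightarrow> i = j" for i j using permutes_inj[OF p'(1)] by (auto simp: inj_eq)
    \<comment> \<open>Row m has no admissible column beyond m, so column k is taken there. This
      starts the downward induction in the rows k..m.\<close>
    have last: "p' m = k" using high[of m] im[of m] assms by auto
    have "p' i = cyc k m i" for i
    proof (cases "i \<in> {1..m}")
      case True
      show ?thesis
      proof (cases "i < k")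
        case True
        \<comment> \<open>The rows above k are lower triangular: a value below i is already the
          image of itself, contradicting injectivity.\<close>
        have "p' i = i" if "i < k" "i \<in> {1..m}" for i
          using that
        proof (induction i rule: less_induct)
          case (less i)
          show ?case
          proof (rule ccontr)
            assume "p' i \<noteq> i"
            then have "p' i < i" using low[of i] less.prems by simp
            moreover have "p' (p' i) = p' i" using calculation less.prems im[of i] by (intro less.IH) auto
            ultimately show False using inj by simp
          qed
        qed
        then show ?thesis using True \<open>i \<in> {1..m}\<close> by (simp add: cyc_def)
      next
        case False
        \<comment> \<open>Downward from m: column k is used by row m, and any column beyond
          \<open>Suc i\<close> is already used by the row just before it.\<close>
        have up: "p' i = Suc i" if "k \<le> i" "i < m" for i
          using that
        proof (induction "m - i" arbitrary: i rule: less_induct)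
          case less
          have i: "i \<in> {1..m}" using less.prems \<open>k \<noteq> 0\<close> by auto
          have "p' i \<noteq> k" using last inj[of i m] less.prems by simp
          then have gt: "i < p' i" using high[OF i] less.prems by simp
          show ?case
          proof (rule ccontr)
            assume ne: "p' i \<noteq> Suc i"
            then obtain j where j: "p' i = Suc j" "i < j" using gt by (metis Suc_lessI less_imp_Suc_add lessI less_Suc_eq)
            then have "j < m" using im[OF i] by simp
            then have "p' j = Suc j" using j less by (intro less.hyps) auto
            then show False using j inj[of i j] by simp
          qed
        qed
        then show ?thesis using False True last by (cases "i = m") (auto simp: cyc_def)
      qed
    next
      case False
      then show ?thesis using p'(1) cp(1) by (metis permutes_def)
    qed
    then show "p' = cyc k m" by blast
  qed
  \<comment> \<open>The m - k entries -1 on the cycle cancel its sign (-1)^(m - k).\<close>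
  also have "(\<Prod>i=1..m. iexp k i (cyc k m i)) = (\<Prod>i\<in>{k..<m}. - 1)"
  proof (rule prod.mono_neutral_cong_right)
    show "\<forall>i\<in>{1..m} - {k..<m}. iexp k i (cyc k m i) = 1" using assms False
      by (auto simp: iexp_def cyc_def)
  qed (use assms False in \<open>auto simp: iexp_def cyc_def\<close>)
  finally show ?thesis using cp(2) by (simp flip: power_mult_distrib)
qed

lemma log_arg0_exp: "log_arg0 (exp w) = of_real (Re w)"
  by (simp add: log_arg0_def)

lemma log_argmpi_exp: "log_argmpi (exp w) = of_real (Re w) - of_real pi * \<i>"
  by (simp add: log_argmpi_def)

text \<open>The prescribed start value is the logarithm of modulus only, so a candidate has to be
  checked at the base point only for zero imaginary part.\<close>

lemma cont_log_arg0:
  assumes "continuous_on (pcube m) L" "\<And>y. y \<in> pcube m \<Longrightarrow> exp (L y) = g y" "Im (L (pbase m)) = 0"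
    and "s \<in> pcube m"
  shows "cont_log (pcube m) (pbase m) g (log_arg0 (g (pbase m))) s = L s"
  using assms by (intro cont_log_eq) (auto simp: log_arg0_exp complex_eq_iff pbase_in_pcube simp flip: assms(2))

lemma cont_log_argmpi:
  assumes "continuous_on (pcube m) L" "\<And>y. y \<in> pcube m \<Longrightarrow> exp (L y) = g y" "Im (L (pbase m)) = - pi"
    and "s \<in> pcube m"
  shows "cont_log (pcube m) (pbase m) g (log_argmpi (g (pbase m))) s = L s"
  using assms by (intro cont_log_eq) (auto simp: log_argmpi_exp complex_eq_iff pbase_in_pcube simp flip: assms(2))

section \<open>The pulled back integrand\<close>

definition iota_sign :: "nat \<Rightarrow> nat \<Rightarrow> complex" where
  "iota_sign k j = (if j = k then -1 else 1)"

text \<open>Summation by parts. It is applied to logarithms of t_j, where t_0 = 1 explains the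
  hypothesis: the exponents a_j - b_(j+1) and the part of (t_(j-1) - t_j)^(b_j - a_j) coming from
  t_(j-1) combine, leaving a_j on the increment log t_j - log t_(j-1).\<close>

lemma abel_sum:
  fixes a b t :: "nat \<Rightarrow> complex"
  assumes "t 0 = 0"
  shows "(\<Sum>j=1..n. (a j - (if j = n then 0 else b (j + 1))) * t j) + (\<Sum>j=1..n. (b j - a j) * t (j - 1))
    = (\<Sum>j=1..n. a j * (t j - t (j - 1)))"
proof -
  have *: "(\<Sum>j=1..n. b j * t (j - 1)) = (\<Sum>j=1..n. (if j = n then 0 else b (j + 1)) * t j)"
  proof (cases n)
    case (Suc n')
    have "(\<Sum>j=1..Suc n'. b j * t (j - 1)) = (\<Sum>j=0..n'. b (Suc j) * t j)"
      using sum.shift_bounds_cl_Suc_ivl[of "\<lambda>j. b j * t (j - 1)" 0 n'] by simp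
    also have "\<dots> = (\<Sum>j=1..n'. b (Suc j) * t j)"
      using assms by (simp add: sum.atLeast_Suc_atMost)
    also have "\<dots> = (\<Sum>j=1..Suc n'. (if j = Suc n' then 0 else b (j + 1)) * t j)" by simp
    finally show ?thesis using Suc by simp
  qed simp
  show ?thesis using *
    by (simp add: left_diff_distrib right_diff_distrib sum_subtractf)
qed

locale twisted_cell =
  fixes m k :: nat and x \<epsilon> :: real and c :: "nat \<Rightarrow> nat"
  assumes m: "1 \<le> m" and k: "k \<le> m" and e: "0 < \<epsilon>" "\<epsilon> < 1/2" and x: "0 < x"
    and small: "x * (\<Prod>j=1..m. zbound \<epsilon> (iota_sign k j)) < 1"
begin

abbreviation "zl j s \<equiv> zlog \<epsilon> (c j) (s j)"
abbreviation "wl j s \<equiv> wlog \<epsilon> (c j) (s j)"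
abbreviation "T s \<equiv> iota m x k (reg_cell \<epsilon> c s)"
abbreviation "Q s \<equiv> cell_arg m x (iota_sign k) \<epsilon> c s"
abbreviation "\<Lambda> s \<equiv> Ln (1 - Q s)"

definition tlog :: "nat \<Rightarrow> (nat \<Rightarrow> real) \<Rightarrow> complex" where
  "tlog i s = (if k = 0 \<or> i < k then (\<Sum>j=1..i. zl j s)
               else zl k s - of_real (ln x) - (\<Sum>j=i+1..m. zl j s))"

lemma in_cube: "s \<in> pcube m \<Longrightarrow> j \<in> {1..m} \<Longrightarrow> s j \<in> {0..1}"
  by (auto simp: pcube_def PiE_def Pi_def)

lemma exp_zl: "s \<in> pcube m \<Longrightarrow> j \<in> {1..m} \<Longrightarrow> exp (zl j s) = reg_cell \<epsilon> c s j"
  using exp_zlog[OF e in_cube] by (simp add: reg_cell_def)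

lemma exp_wl: "s \<in> pcube m \<Longrightarrow> j \<in> {1..m} \<Longrightarrow> exp (wl j s) = 1 - reg_cell \<epsilon> c s j"
  using exp_wlog[OF e in_cube] by (simp add: reg_cell_def)

lemma continuous_zl: "j \<in> {1..m} \<Longrightarrow> continuous_on (pcube m) (zl j)"
  by (intro continuous_on_pcube_coord continuous_on_zlog e)

lemma continuous_wl: "j \<in> {1..m} \<Longrightarrow> continuous_on (pcube m) (wl j)"
  by (intro continuous_on_pcube_coord continuous_on_wlog e)

lemma Im_zl_base: "j \<in> {1..m} \<Longrightarrow> Im (zl j (pbase m)) = 0"
  using e Im_Ln_of_real[of "1 - \<epsilon>"] by (auto simp: zlog_def pbase_def)

lemma Im_wl_base: "j \<in> {1..m} \<Longrightarrow> Im (wl j (pbase m)) = 0"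
  using e Im_Ln_of_real[of "1 - \<epsilon>"] by (auto simp: wlog_def pbase_def)

lemma exp_tlog:
  assumes "s \<in> pcube m" "i \<le> m"
  shows "exp (tlog i s) = T s i"
proof (cases "k = 0 \<or> i < k")
  case True
  have "(\<Prod>j=1..i. exp (zl j s)) = (\<Prod>j=1..i. reg_cell \<epsilon> c s j)"
    using assms by (intro prod.cong refl exp_zl) auto
  then show ?thesis using True by (simp add: tlog_def iota_def exp_sum)
next
  case False
  have 1: "(\<Prod>j=i+1..m. exp (zl j s)) = (\<Prod>j=i+1..m. reg_cell \<epsilon> c s j)"
    using assms by (intro prod.cong refl exp_zl) auto
  have 2: "exp (zl k s) = reg_cell \<epsilon> c s k" using assms False k by (intro exp_zl) auto
  show ?thesis using False 1 2 x by (simp add: tlog_def iota_def exp_sum exp_diff exp_of_real)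
qed

lemma continuous_tlog: "i \<le> m \<Longrightarrow> continuous_on (pcube m) (tlog i)"
  unfolding tlog_def[abs_def] using k
  by (cases "k = 0 \<or> i < k") (auto intro!: continuous_intros continuous_zl)

lemma Im_tlog_base: "i \<le> m \<Longrightarrow> Im (tlog i (pbase m)) = 0"
  unfolding tlog_def using k by (auto simp: Im_zl_base)

lemma tlog_step:
  assumes "j \<in> {1..m}" "j \<noteq> k"
  shows "tlog j s = tlog (j - 1) s + zl j s"
proof (cases "k = 0 \<or> j < k")
  case True
  obtain i where "j = Suc i" using assms by (cases j) auto
  then show ?thesis using True by (auto simp: tlog_def)
next
  case False
  then have "{j - 1 + 1..m} = insert j {j+1..m}" using assms by auto
  then show ?thesis using False assms by (auto simp: tlog_def)
qed

lemma Q_exp: "Q s = exp (of_real (ln x) + (\<Sum>j=1..m. iota_sign k j * zl j s))"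
  using x by (simp add: cell_arg_def exp_add exp_sum exp_of_real)

text \<open>The logarithmic form of t_(k-1) = t_k Q: the index k is the one place where
  \<open>iota\<close> switches formulas and t_(k-1), t_k no longer differ by the factor z_k.\<close>

lemma tlog_step_k:
  assumes "1 \<le> k"
  shows "tlog (k - 1) s = tlog k s + (of_real (ln x) + (\<Sum>j=1..m. iota_sign k j * zl j s))"
proof -
  have "(\<Sum>j=1..m. iota_sign k j * zl j s) = (\<Sum>j=1..k-1. zl j s) + (\<Sum>j=k..m. iota_sign k j * zl j s)"
  proof -
    have "{1..m} = {1..k-1} \<union> {k..m}" using assms k by auto
    then have "(\<Sum>j=1..m. iota_sign k j * zl j s)
       = (\<Sum>j=1..k-1. iota_sign k j * zl j s) + (\<Sum>j=k..m. iota_sign k j * zl j s)"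
      using assms by (simp only:) (rule sum.union_disjoint, auto)
    moreover have "(\<Sum>j=1..k-1. iota_sign k j * zl j s) = (\<Sum>j=1..k-1. zl j s)"
      using assms by (intro sum.cong) (auto simp: iota_sign_def)
    ultimately show ?thesis by simp
  qed
  also have "(\<Sum>j=k..m. iota_sign k j * zl j s) = - zl k s + (\<Sum>j=k+1..m. zl j s)"
    using k by (simp add: sum.atLeast_Suc_atMost[of k m] iota_sign_def)
  finally show ?thesis using assms by (simp add: tlog_def)
qed

lemma norm_Q: "s \<in> pcube m \<Longrightarrow> norm (Q s) < 1"
  by (rule le_less_trans[OF norm_cell_arg_le[OF e _ x in_cube] small]) (auto simp: iota_sign_def)

lemma exp_\<Lambda>: "s \<in> pcube m \<Longrightarrow> exp (\<Lambda> s) = 1 - Q s"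
  using norm_Q[of s] by (intro exp_Ln) auto

lemma continuous_\<Lambda>: "continuous_on (pcube m) \<Lambda>"
proof -
  have "continuous_on (pcube m) (\<lambda>s. 1 - Q s)"
    unfolding cell_arg_def by (intro continuous_intros continuous_zl)
  moreover have "1 - Q s \<notin> \<real>\<^sub>\<le>\<^sub>0" if "s \<in> pcube m" for s
    using norm_Q[OF that] complex_Re_le_cmod[of "Q s"] by (auto simp: complex_nonpos_Reals_iff)
  ultimately show ?thesis by (intro continuous_on_Ln') auto
qed

text \<open>At the base point all z_j lie on the positive axis, so Q is real with |Q| < 1 and the
  principal logarithm of 1 - Q is real.\<close>

lemma Im_\<Lambda>_base: "Im (\<Lambda> (pbase m)) = 0"
proof -
  have "(\<Sum>j=1..m. iota_sign k j * zl j (pbase m)) \<in> \<real>"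
    by (intro sum_in_Reals Reals_mult) (auto simp: iota_sign_def complex_is_Real_iff Im_zl_base)
  then have "of_real (ln x) + (\<Sum>j=1..m. iota_sign k j * zl j (pbase m)) \<in> \<real>" by simp
  then have "Q (pbase m) \<in> \<real>" unfolding Q_exp by (elim Reals_cases) (simp add: exp_of_real)
  then obtain r where r: "Q (pbase m) = of_real r" by (elim Reals_cases)
  then have "\<bar>r\<bar> < 1" using norm_Q[OF pbase_in_pcube] by simp
  then show ?thesis unfolding r using Im_Ln_of_real[of "1 - r"] by simp
qed

lemma log_t:
  assumes "s \<in> pcube m" "j \<in> {1..m}"
  shows "cont_log (pcube m) (pbase m) (\<lambda>y. T y j) (log_arg0 (T (pbase m) j)) s = tlog j s"
  using assms cont_log_arg0[of m "tlog j" "\<lambda>y. T y j" s]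
  by (simp add: exp_tlog continuous_tlog Im_tlog_base)

lemma T_diff:
  assumes "s \<in> pcube m" "j \<in> {1..m}" "j \<noteq> k"
  shows "T s (j - 1) - T s j = exp (tlog (j - 1) s + wl j s)"
proof -
  have "j - 1 \<le> m" using assms(2) by auto
  then have "T s j = T s (j - 1) * reg_cell \<epsilon> c s j"
    using assms tlog_step[OF assms(2,3), of s] exp_zl[OF assms(1,2)] exp_tlog[OF assms(1), of j]
      exp_tlog[OF assms(1), of "j - 1"] by (simp add: exp_add)
  moreover have "exp (tlog (j - 1) s) = T s (j - 1)" using assms by (intro exp_tlog) auto
  ultimately show ?thesis
    by (simp add: exp_add exp_wl[OF assms(1,2)] right_diff_distrib)
qed

text \<open>Here t_(k-1) - t_k = - t_k (1 - Q). The factor -1 is written as e^(-pi i), the choice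
  that agrees with the argument -pi prescribed on the chamber.\<close>

lemma T_diff_k:
  assumes "s \<in> pcube m" "1 \<le> k"
  shows "T s (k - 1) - T s k = exp (tlog k s + \<Lambda> s - of_real pi * \<i>)"
proof -
  have "T s (k - 1) = T s k * Q s"
    using tlog_step_k[OF assms(2), of s] exp_tlog[OF assms(1), of k] k
      exp_tlog[OF assms(1), of "k - 1"] by (simp add: exp_add Q_exp)
  moreover have "exp (tlog k s) = T s k" using assms k by (intro exp_tlog) auto
  moreover have "exp (complex_of_real pi * \<i>) = -1" by (simp add: mult.commute)
  ultimately show ?thesis
    by (simp add: exp_add exp_diff exp_\<Lambda>[OF assms(1)] right_diff_distrib mult.commute)
qed

lemma log_dt:
  assumes "s \<in> pcube m" "j \<in> {1..m}" "j \<noteq> k"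
  shows "cont_log (pcube m) (pbase m) (\<lambda>y. T y (j - 1) - T y j)
    (log_arg0 (T (pbase m) (j - 1) - T (pbase m) j)) s = tlog (j - 1) s + wl j s"
proof (rule cont_log_arg0[where g = "\<lambda>y. T y (j - 1) - T y j"])
  show "continuous_on (pcube m) (\<lambda>s. tlog (j - 1) s + wl j s)"
    using assms by (intro continuous_intros continuous_tlog continuous_wl) auto
qed (use assms T_diff Im_tlog_base[of "j - 1"] Im_wl_base in auto)

lemma log_dt_k:
  assumes "s \<in> pcube m" "1 \<le> k"
  shows "cont_log (pcube m) (pbase m) (\<lambda>y. T y (k - 1) - T y k)
    (log_argmpi (T (pbase m) (k - 1) - T (pbase m) k)) s = tlog k s + \<Lambda> s - of_real pi * \<i>"
proof (rule cont_log_argmpi[where g = "\<lambda>y. T y (k - 1) - T y k"])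
  show "continuous_on (pcube m) (\<lambda>s. tlog k s + \<Lambda> s - of_real pi * \<i>)"
    using assms k by (intro continuous_intros continuous_tlog continuous_\<Lambda>) auto
qed (use assms T_diff_k Im_tlog_base[of k] Im_\<Lambda>_base k in auto)

text \<open>For k = 0 one has x t_m = Q, but for k > 0 one has x t_m = z_k: the factors 1 - Q and 1
  - z_k exchange their roles.\<close>

lemma log_1_minus_xt:
  assumes "s \<in> pcube m"
  shows "cont_log (pcube m) (pbase m) (\<lambda>y. 1 - of_real x * T y m)
    (log_arg0 (1 - of_real x * T (pbase m) m)) s = (if k = 0 then \<Lambda> s else wl k s)"
proof (rule cont_log_arg0[where g = "\<lambda>y. 1 - of_real x * T y m"])
  show "continuous_on (pcube m) (\<lambda>s. if k = 0 then \<Lambda> s else wl k s)"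
    using continuous_\<Lambda> continuous_wl[of k] k by (cases "k = 0") auto
  show "exp (if k = 0 then \<Lambda> y else wl k y) = 1 - of_real x * T y m" if y: "y \<in> pcube m" for y
  proof (cases "k = 0")
    case True
    then have "of_real x * T y m = Q y"
      using exp_zl[OF y] by (auto simp: iota_def cell_arg_def iota_sign_def intro!: prod.cong)
    then show ?thesis using True exp_\<Lambda>[OF y] by simp
  next
    case False
    then show ?thesis using exp_wl[OF y, of k] k x by (simp add: iota_def)
  qed
  show "Im (if k = 0 then \<Lambda> (pbase m) else wl k (pbase m)) = 0"
    using Im_\<Lambda>_base Im_wl_base[of k] k by auto
qed (use assms in auto)

lemma u_branch_eq:
  assumes s: "s \<in> pcube m" and b0: "b 0 = 0"
  shows "u_branch m a b x k (\<lambda>s. T s) s =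
    exp ((\<Sum>j=1..m. expo0 a b k j * zl j s + expo1 a b k j * wl j s) - b k * of_real (ln x)
      + (if k = 0 then - a 0 * \<Lambda> s else (b k - a k) * (\<Lambda> s - of_real pi * \<i>)))"
proof -
  let ?bb = "\<lambda>j. if j = m then 0 else b (j + 1)"
  define D where "D j = (if j = k then tlog k s + \<Lambda> s - of_real pi * \<i> else tlog (j - 1) s + wl j s)" for j
  have "k = 0 \<or> 0 < k" by auto
  then have t0: "tlog 0 s = 0" unfolding tlog_def by simp
  have D: "cont_log (pcube m) (pbase m) (\<lambda>y. T y (j - 1) - T y j)
      ((if j = k then log_argmpi else log_arg0) (T (pbase m) (j - 1) - T (pbase m) j)) s = D j" if "j \<in> {1..m}" for j
    using log_dt[OF s that] log_dt_k[OF s] that by (cases "j = k") (auto simp: D_def)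
  have "u_branch m a b x k (\<lambda>s. T s) s = exp (- a 0 * (if k = 0 then \<Lambda> s else wl k s)
      + (\<Sum>j=1..m. (a j - ?bb j) * tlog j s) + (\<Sum>j=1..m. (b j - a j) * D j))"
    unfolding u_branch_def Let_def log_1_minus_xt[OF s]
    by (intro arg_cong[where f = exp] arg_cong2[where f = "(+)"] sum.cong refl)
       (simp_all only: log_t[OF s] D)
  also have "(\<Sum>j=1..m. (b j - a j) * D j) = (\<Sum>j=1..m. (b j - a j) * tlog (j - 1) s) + (\<Sum>j=1..m. (b j - a j) * (D j - tlog (j - 1) s))"
    by (simp add: sum.distrib[symmetric] algebra_simps)
  finally have u0: "u_branch m a b x k (\<lambda>s. T s) s = exp (- a 0 * (if k = 0 then \<Lambda> s else wl k s)
      + (\<Sum>j=1..m. (a j - ?bb j) * tlog j s)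
      + ((\<Sum>j=1..m. (b j - a j) * tlog (j - 1) s) + (\<Sum>j=1..m. (b j - a j) * (D j - tlog (j - 1) s))))" .
  have u: "u_branch m a b x k (\<lambda>s. T s) s = exp (- a 0 * (if k = 0 then \<Lambda> s else wl k s)
      + (\<Sum>j=1..m. a j * (tlog j s - tlog (j - 1) s) + (b j - a j) * (D j - tlog (j - 1) s)))"
    unfolding u0 sum.distrib abel_sum[of "\<lambda>j. tlog j s", OF t0, of a m b, symmetric]
    by (simp only: add.assoc)
  have ne: "a j * (tlog j s - tlog (j - 1) s) + (b j - a j) * (D j - tlog (j - 1) s) = a j * zl j s + (b j - a j) * wl j s"
    if "j \<in> {1..m}" "j \<noteq> k" for j
    using tlog_step[OF that] that by (simp add: D_def)
  show ?thesis
  proof (cases "k = 0")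
    case True
    have "(\<Sum>j=1..m. a j * (tlog j s - tlog (j - 1) s) + (b j - a j) * (D j - tlog (j - 1) s))
      = (\<Sum>j=1..m. expo0 a b k j * zl j s + expo1 a b k j * wl j s)"
      using True ne b0 by (intro sum.cong refl) (auto simp: expo0_def expo1_def)
    then show ?thesis unfolding u using True b0 by simp
  next
    case False
    then have kin: "k \<in> {1..m}" using k by auto
    \<comment> \<open>Both increments at k contain - log Q, with weights a_k and b_k - a_k, so - b_k
      log Q remains. Distributed over the z_j it turns a_j into a_j - b_k, contributes b_k to z_k,
      and yields x^(- b_k).\<close>
    have kterm: "a k * (tlog k s - tlog (k - 1) s) + (b k - a k) * (D k - tlog (k - 1) s)
      = (b k - a k) * (\<Lambda> s - of_real pi * \<i>) - b k * of_real (ln x) - b k * (\<Sum>j=1..m. iota_sign k j * zl j s)"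
      using tlog_step_k[of s] False by (simp add: D_def algebra_simps)
    have sg: "(\<Sum>j=1..m. iota_sign k j * zl j s) = - zl k s + (\<Sum>j\<in>{1..m}-{k}. zl j s)"
      using sum.remove[OF _ kin, of "\<lambda>j. iota_sign k j * zl j s"] by (simp add: iota_sign_def)
    have "(\<Sum>j=1..m. a j * (tlog j s - tlog (j - 1) s) + (b j - a j) * (D j - tlog (j - 1) s))
      = a k * (tlog k s - tlog (k - 1) s) + (b k - a k) * (D k - tlog (k - 1) s)
        + (\<Sum>j\<in>{1..m}-{k}. a j * zl j s + (b j - a j) * wl j s)"
      unfolding sum.remove[OF finite_atLeastAtMost kin]
      by (intro arg_cong2[where f = "(+)"] sum.cong refl ne) auto
    also have "\<dots> = (b k - a k) * (\<Lambda> s - of_real pi * \<i>) - b k * of_real (ln x) + b k * zl k s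
        + (\<Sum>j\<in>{1..m}-{k}. (a j - b k) * zl j s + (b j - a j) * wl j s)"
      unfolding kterm sg by (simp add: algebra_simps sum.distrib sum_subtractf sum_distrib_left)
    finally have S: "(\<Sum>j=1..m. a j * (tlog j s - tlog (j - 1) s) + (b j - a j) * (D j - tlog (j - 1) s)) = \<dots>" .
    have "(\<Sum>j=1..m. expo0 a b k j * zl j s + expo1 a b k j * wl j s)
      = b k * zl k s - a 0 * wl k s + (\<Sum>j\<in>{1..m}-{k}. (a j - b k) * zl j s + (b j - a j) * wl j s)"
      using sum.remove[OF _ kin, of "\<lambda>j. expo0 a b k j * zl j s + expo1 a b k j * wl j s"]
      by (simp add: expo0_def expo1_def)
    then have E: "(\<Sum>j\<in>{1..m}-{k}. (a j - b k) * zl j s + (b j - a j) * wl j s)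
      = (\<Sum>j=1..m. expo0 a b k j * zl j s + expo1 a b k j * wl j s) - b k * zl k s + a 0 * wl k s"
      by simp
    show ?thesis unfolding u S E using False by (simp add: algebra_simps)
  qed
qed

end

section \<open>Pulling back the form\<close>

lemma detn_cong:
  assumes "\<And>i j. i \<in> {1..m} \<Longrightarrow> j \<in> {1..m} \<Longrightarrow> A i j = B i j"
  shows "detn m A = detn m B"
  unfolding detn_def
proof (intro sum.cong refl arg_cong2[where f = "(*)"] prod.cong)
  fix p i assume "p \<in> {p. p permutes {1..m}}" "i \<in> {1..m}"
  then show "A i (p i) = B i (p i)" using permutes_in_image[of p "{1..m}" i] by (intro assms) auto
qed

text \<open>With t_0 = 1 it turns the factors t_m and t_(j-1) from the denominator of
  \<open>phi_0\<close> into the product of all t_j, which cancels against the row factors of the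
  Jacobian.\<close>

lemma prod_shift:
  fixes f :: "nat \<Rightarrow> complex"
  shows "f m * (\<Prod>j=1..m. f (j - 1)) = f 0 * (\<Prod>j=1..m. f j)"
  by (induction m) (simp_all add: mult_ac)

context twisted_cell
begin

lemma jacob_eq:
  assumes s: "s \<in> pcube m" and i: "i \<in> {1..m}" and j: "j \<in> {1..m}"
  shows "jacob (\<lambda>s. T s) s i j = T s i * iexp k i j * (reg_speed \<epsilon> (c j) (s j) * exp (- zl j s))"
proof -
  let ?z = "\<lambda>\<sigma>. reg_path \<epsilon> (c j) \<sigma>"
  let ?h = "\<lambda>\<sigma>. T (s(j := \<sigma>)) i"
  have nz: "?z (s j) \<noteq> 0" using reg_path_nonzero[OF e in_cube[OF s j]] by simp
  have ez: "exp (- zl j s) = 1 / ?z (s j)"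
    using exp_zlog[OF e in_cube[OF s j]] by (simp add: exp_minus divide_inverse)
  have h: "?h (s j) = T s i" by simp
  have d: "(?z has_vector_derivative reg_speed \<epsilon> (c j) (s j)) (at (s j))"
    by (rule reg_path_has_vector_derivative)
  have pr: "(\<Prod>l\<in>S. reg_cell \<epsilon> c (s(j := \<sigma>)) l)
      = (if j \<in> S then ?z \<sigma> * (\<Prod>l\<in>S-{j}. reg_cell \<epsilon> c s l) else (\<Prod>l\<in>S. reg_cell \<epsilon> c s l))"
    if "finite S" for S \<sigma>
  proof (cases "j \<in> S")
    case True
    have "(\<Prod>l\<in>S-{j}. reg_cell \<epsilon> c (s(j := \<sigma>)) l) = (\<Prod>l\<in>S-{j}. reg_cell \<epsilon> c s l)"
      by (intro prod.cong) (auto simp: reg_cell_def)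
    then show ?thesis using True prod.remove[OF that True, of "reg_cell \<epsilon> c (s(j := \<sigma>))"] by (simp add: reg_cell_def)
  next
    case False
    then show ?thesis by (auto simp: reg_cell_def intro!: prod.cong)
  qed
  have rc: "reg_cell \<epsilon> c (s(j := \<sigma>)) j = ?z \<sigma>"
      "j \<noteq> k \<Longrightarrow> reg_cell \<epsilon> c (s(j := \<sigma>)) k = reg_cell \<epsilon> c s k" for \<sigma>
    by (simp_all add: reg_cell_def)
  \<comment> \<open>As a function of the single coordinate z_j, t_i is A z_j, constant, or A / z_j
    with A independent of z_j; its logarithmic derivative is \<open>iexp k i j\<close> /
    z_j.\<close>
  consider A where "iexp k i j = 1" "\<And>\<sigma>. ?h \<sigma> = A * ?z \<sigma>"
    | A where "iexp k i j = 0" "\<And>\<sigma>. ?h \<sigma> = A"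
    | A where "iexp k i j = -1" "\<And>\<sigma>. ?h \<sigma> = A / ?z \<sigma>"
  proof (cases "k = 0 \<or> i < k")
    case True
    show ?thesis
    proof (cases "j \<le> i")
      case True
      then show ?thesis using \<open>k = 0 \<or> i < k\<close> j
        by (intro that(1)[of "\<Prod>l\<in>{1..i}-{j}. reg_cell \<epsilon> c s l"]) (auto simp: iexp_def iota_def pr)
    next
      case False
      then show ?thesis using \<open>k = 0 \<or> i < k\<close> j
        by (intro that(2)[of "\<Prod>l\<in>{1..i}. reg_cell \<epsilon> c s l"]) (auto simp: iexp_def iota_def pr)
    qed
  next
    case False
    let ?P = "\<lambda>S. \<Prod>l\<in>S. reg_cell \<epsilon> c s l"
    consider "j = k" | "j \<noteq> k" "i < j" | "j \<noteq> k" "j \<le> i" by linarith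
    then show ?thesis
    proof cases
      case 1
      then show ?thesis using False
        by (intro that(1)[of "1 / (of_real x * ?P {i+1..m})"]) (simp_all add: iexp_def iota_def pr rc flip: 1)
    next
      case 2
      then show ?thesis using False j
        by (intro that(3)[of "reg_cell \<epsilon> c s k / (of_real x * ?P ({i+1..m}-{j}))"])
          (auto simp: iexp_def iota_def pr rc)
    next
      case 3
      then show ?thesis using False j
        by (intro that(2)[of "reg_cell \<epsilon> c s k / (of_real x * ?P {i+1..m})"])
          (auto simp: iexp_def iota_def pr rc)
    qed
  qed
  then show ?thesis
  proof cases
    case (1 A)
    have "(?h has_vector_derivative A * reg_speed \<epsilon> (c j) (s j)) (at (s j))"
      unfolding 1(2) by (intro has_vector_derivative_mult_right d)
    moreover have "T s i = A * ?z (s j)" using 1(2)[of "s j"] h by simp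
    ultimately show ?thesis using 1(1) nz by (simp add: jacob_def vector_derivative_at ez)
  next
    case (2 A)
    have "(?h has_vector_derivative 0) (at (s j))" unfolding 2(2) by simp
    then show ?thesis using 2(1) by (simp add: jacob_def vector_derivative_at)
  next
    case (3 A)
    have "((\<lambda>\<sigma>. inverse (?z \<sigma>)) has_vector_derivative reg_speed \<epsilon> (c j) (s j) * (- (inverse (?z (s j)) ^ 2))) (at (s j))"
      using field_vector_diff_chain_at[OF d, of inverse "- (inverse (?z (s j)) ^ 2)"] DERIV_inverse[OF nz]
      by (simp add: o_def numeral_2_eq_2)
    then have "(?h has_vector_derivative A * (reg_speed \<epsilon> (c j) (s j) * (- (inverse (?z (s j)) ^ 2)))) (at (s j))"
      unfolding 3(2) divide_inverse by (intro has_vector_derivative_mult_right)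
    moreover have "T s i = A / ?z (s j)" using 3(2)[of "s j"] h by simp
    ultimately show ?thesis using 3(1) nz
      by (simp add: jacob_def vector_derivative_at ez power2_eq_square field_simps)
  qed
qed

lemma detn_jacob:
  assumes "s \<in> pcube m"
  shows "detn m (jacob (\<lambda>s. T s) s) = (\<Prod>i=1..m. T s i) * (\<Prod>j=1..m. reg_speed \<epsilon> (c j) (s j) * exp (- zl j s))"
proof -
  have "detn m (jacob (\<lambda>s. T s) s)
      = detn m (\<lambda>i j. T s i * iexp k i j * (reg_speed \<epsilon> (c j) (s j) * exp (- zl j s)))"
    by (rule detn_cong) (rule jacob_eq[OF assms])
  then show ?thesis by (simp only: detn_scale detn_iexp[OF k m] mult_1_right)
qed

text \<open>The extra factor \<open>- Q / (1 - Q)\<close> for \<open>0 < k\<close> comes from \<open>t_(k-1) - t_k = - t_k (1 - Q)\<close>, where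
  \<open>t_(k-1) = t_k Q\<close>; all other differences are \<open>t_(j-1) (1 - z_j)\<close>.\<close>
lemma phi0_jacob:
  assumes s: "s \<in> pcube m"
  shows "phi0_coef m (T s) * detn m (jacob (\<lambda>s. T s) s) =
    (\<Prod>j=1..m. reg_speed \<epsilon> (c j) (s j) * exp (- zl j s - (if j = k then 0 else wl j s)))
     * (if k = 0 then 1 else - exp (of_real (ln x) + (\<Sum>j=1..m. iota_sign k j * zl j s) - \<Lambda> s))"
proof -
  have T0: "T s 0 = 1" using exp_tlog[OF s, of 0] by (cases "k = 0") (auto simp: iota_def)
  have nz: "T s i \<noteq> 0" if "i \<le> m" for i using exp_tlog[OF s that] by (metis exp_not_eq_zero)
  \<comment> \<open>The quotient (t_(j-1) - t_j) / t_(j-1): it is 1 - z_j for j \<noteq> k and -(1 -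
    Q)/Q for j = k.\<close>
  define W where "W j = (if j = k then - exp (\<Lambda> s - (of_real (ln x) + (\<Sum>j=1..m. iota_sign k j * zl j s))) else exp (wl j s))" for j
  have step: "T s (j - 1) - T s j = T s (j - 1) * W j" if j: "j \<in> {1..m}" for j
  proof (cases "j = k")
    case False
    have "j - 1 \<le> m" using j by auto
    then show ?thesis using False T_diff[OF s j False] exp_tlog[OF s, of "j - 1"] by (simp add: W_def exp_add)
  next
    case True
    then have k1: "1 \<le> k" "k - 1 \<le> m" using j by auto
    have "exp (complex_of_real pi * \<i>) = -1" by (simp add: mult.commute)
    then have "T s (k - 1) - T s k = - exp (tlog k s + \<Lambda> s)"
      unfolding T_diff_k[OF s k1(1)] exp_diff by simp
    also have "tlog k s + \<Lambda> s
        = tlog (k - 1) s + (\<Lambda> s - (of_real (ln x) + (\<Sum>j=1..m. iota_sign k j * zl j s)))"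
      unfolding tlog_step_k[OF k1(1)] by simp
    finally show ?thesis using True exp_tlog[OF s k1(2)] by (simp add: W_def exp_add)
  qed
  have "(\<Prod>j=1..m. T s (j - 1) - T s j) = (\<Prod>j=1..m. T s (j - 1)) * (\<Prod>j=1..m. W j)"
    using step by (simp add: prod.distrib)
  then have "T s m * (\<Prod>j=1..m. T s (j - 1) - T s j) = (\<Prod>j=1..m. T s j) * (\<Prod>j=1..m. W j)"
    using prod_shift[of "T s" m] T0 by (simp add: mult.assoc[symmetric])
  moreover have "(\<Prod>j=1..m. T s j) \<noteq> 0" using nz by (simp add: prod_zero_iff)
  ultimately have "phi0_coef m (T s) * detn m (jacob (\<lambda>s. T s) s)
     = (\<Prod>j=1..m. reg_speed \<epsilon> (c j) (s j) * exp (- zl j s)) / (\<Prod>j=1..m. W j)"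
    unfolding phi0_coef_def detn_jacob[OF s] by simp
  moreover have "1 / (\<Prod>j=1..m. W j) = (\<Prod>j=1..m. exp (- (if j = k then 0 else wl j s)))
      * (if k = 0 then 1 else - exp (of_real (ln x) + (\<Sum>j=1..m. iota_sign k j * zl j s) - \<Lambda> s))"
  proof (cases "k = 0")
    case True
    then have "(\<Prod>j=1..m. W j) = (\<Prod>j=1..m. exp (wl j s))" by (intro prod.cong) (auto simp: W_def)
    moreover have "(\<Prod>j=1..m. exp (- (if j = k then 0 else wl j s))) = (\<Prod>j=1..m. 1 / exp (wl j s))"
      using True by (intro prod.cong) (auto simp: exp_minus divide_inverse)
    ultimately show ?thesis using True by (simp add: prod_dividef)
  next
    case False
    then have kin: "k \<in> {1..m}" using k by auto
    let ?E = "of_real (ln x) + (\<Sum>j=1..m. iota_sign k j * zl j s)"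
    have 1: "(\<Prod>j=1..m. W j) = - exp (\<Lambda> s - ?E) * (\<Prod>j\<in>{1..m}-{k}. exp (wl j s))"
      using prod.remove[OF _ kin, of W] by (simp add: W_def)
    have 2: "(\<Prod>j=1..m. exp (- (if j = k then 0 else wl j s))) = (\<Prod>j\<in>{1..m}-{k}. 1 / exp (wl j s))"
      using prod.remove[OF _ kin, of "\<lambda>j. exp (- (if j = k then 0 else wl j s))"]
      by (simp add: exp_minus divide_inverse)
    have 3: "exp (?E - \<Lambda> s) = 1 / exp (\<Lambda> s - ?E)"
      by (simp only: exp_diff) simp
    show ?thesis unfolding 1 2 3 using False by (simp add: prod_dividef)
  qed
  moreover have "(\<Prod>j=1..m. reg_speed \<epsilon> (c j) (s j) * exp (- zl j s - (if j = k then 0 else wl j s)))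
      = (\<Prod>j=1..m. reg_speed \<epsilon> (c j) (s j) * exp (- zl j s)) * (\<Prod>j=1..m. exp (- (if j = k then 0 else wl j s)))"
    unfolding prod.distrib[symmetric]
    by (intro prod.cong refl) (simp only: mult.assoc exp_add[symmetric] diff_conv_add_uminus)
  ultimately show ?thesis
    by (metis (no_types, lifting) mult.assoc mult.right_neutral times_divide_eq_right)
qed

text \<open>The form contributes 1/z_j for all j but 1/(1 - z_j) only for j \<noteq> k, so the
  second parameter at k is 1 - a_0. For k > 0 its factor -Q/(1 - Q) shifts the first parameters by
  the exponents of Q, raises x^(-b_k) to x^(1 - b_k), lowers the exponent of 1 - Q by 1, and its
  sign changes e^(-pi i (b_k - a_k)) into e^(-pi i (b_k - a_k - 1)).\<close>

lemma integrand_eq: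
  assumes s: "s \<in> pcube m" and b0: "b 0 = 0"
  shows "u_branch m a b x k (\<lambda>s. T s) s * phi0_coef m (T s) * detn m (jacob (\<lambda>s. T s) s) =
    (if k = 0 then 1 else exp (- of_real pi * \<i> * (b k - a k - 1)) * exp ((1 - b k) * of_real (ln x)))
    * ((\<Prod>j=1..m. cell_factor \<epsilon> (c j) (expo0 a b k j + (if k = 0 then 0 else iota_sign k j))
                          (expo1 a b k j + (if j = k then 1 else 0)) (s j))
      * exp (- (if k = 0 then a 0 else a k - b k + 1) * \<Lambda> s))"
proof -
  let ?p = "\<lambda>j. expo0 a b k j + (if k = 0 then 0 else iota_sign k j)"
  let ?q = "\<lambda>j. expo1 a b k j + (if j = k then 1 else 0)"
  let ?V = "\<Prod>j=1..m. reg_speed \<epsilon> (c j) (s j)"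
  let ?E = "\<Sum>j=1..m. expo0 a b k j * zl j s + expo1 a b k j * wl j s"
  let ?Z = "\<Sum>j=1..m. - zl j s - (if j = k then 0 else wl j s)"
  let ?S = "\<Sum>j=1..m. iota_sign k j * zl j s"
  have pr: "(\<Prod>j=1..m. reg_speed \<epsilon> (c j) (s j) * exp (- zl j s - (if j = k then 0 else wl j s))) = ?V * exp ?Z"
    by (simp add: prod.distrib exp_sum)
  have cf: "(\<Prod>j=1..m. cell_factor \<epsilon> (c j) (?p j) (?q j) (s j))
     = ?V * exp (\<Sum>j=1..m. (?p j - 1) * zl j s + (?q j - 1) * wl j s)"
    by (simp add: cell_factor_def prod.distrib exp_sum)
  have lhs: "u_branch m a b x k (\<lambda>s. T s) s * phi0_coef m (T s) * detn m (jacob (\<lambda>s. T s) s)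
    = ?V * (exp (?E - b k * of_real (ln x) + (if k = 0 then - a 0 * \<Lambda> s else (b k - a k) * (\<Lambda> s - of_real pi * \<i>)))
       * exp ?Z * (if k = 0 then 1 else - exp (of_real (ln x) + ?S - \<Lambda> s)))"
    unfolding u_branch_eq[where b = b, OF s b0] mult.assoc phi0_jacob[OF s] pr by (simp only: mult_ac)
  show ?thesis
  proof (cases "k = 0")
    case True
    have "(\<Sum>j=1..m. (?p j - 1) * zl j s + (?q j - 1) * wl j s) = ?E + ?Z"
      unfolding sum.distrib[symmetric] using True by (intro sum.cong) (auto simp: algebra_simps)
    then show ?thesis unfolding lhs cf using True b0 by (simp add: exp_add[symmetric] algebra_simps)
  next
    case False
    have 1: "(\<Sum>j=1..m. (?p j - 1) * zl j s + (?q j - 1) * wl j s) = ?E + ?Z + ?S"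
      unfolding sum.distrib[symmetric] using False by (intro sum.cong) (auto simp: algebra_simps)
    have pi: "exp (- of_real pi * \<i> * (b k - a k - 1)) = - exp (- of_real pi * \<i> * (b k - a k))"
    proof -
      have "- of_real pi * \<i> * (b k - a k - 1) = - of_real pi * \<i> * (b k - a k) + \<i> * of_real pi"
        by (simp add: algebra_simps)
      then show ?thesis by (simp only: exp_add exp_pi_i') simp
    qed
    have "exp (?E - b k * of_real (ln x) + (b k - a k) * (\<Lambda> s - of_real pi * \<i>)) * exp ?Z * exp (of_real (ln x) + ?S - \<Lambda> s)
      = exp (- of_real pi * \<i> * (b k - a k)) * exp ((1 - b k) * of_real (ln x)) * (exp (?E + ?Z + ?S) * exp (- (a k - b k + 1) * \<Lambda> s))"
      unfolding exp_add[symmetric] by (rule arg_cong[where f = exp]) (simp add: algebra_simps)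
    then show ?thesis unfolding lhs cf 1 pi using False by (simp add: mult_ac)
  qed
qed

end

section \<open>Hypergeometric coefficients\<close>

lemma one_minus_powr_coeff:
  fixes \<alpha> :: complex
  shows "(- \<alpha> gchoose n) * (-1) ^ n = pochhammer \<alpha> n / fact n"
  by (simp add: gbinomial_pochhammer)

lemma not_Int_not_nonpos: "z \<notin> \<int> \<Longrightarrow> z \<notin> \<int>\<^sub>\<le>\<^sub>0"
  using nonpos_Ints_subset_Ints by blast

lemma Gamma_plus_of_nat:
  fixes z :: complex
  assumes "z \<notin> \<int>"
  shows "Gamma (z + of_nat n) = Gamma z * pochhammer z n"
  using pochhammer_Gamma[OF not_Int_not_nonpos[OF assms], of n] Gamma_eq_zero_iff[of z] not_Int_not_nonpos[OF assms]
  by (simp add: field_simps)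

lemma pochhammer_not_Int_nonzero: "z \<notin> \<int> \<Longrightarrow> pochhammer z n \<noteq> 0" for z :: complex
  by (auto simp: pochhammer_eq_0_iff)

text \<open>For k > 0 the coordinate z_k enters Q with exponent -1 and its Gamma arguments decrease
  with n. The reflection (z - n)_n = (-1)^n (1 - z)_n brings them back to rising factorials.\<close>

lemma Gamma_minus_of_nat:
  fixes z :: complex
  assumes "z \<notin> \<int>"
  shows "Gamma (z - of_nat n) = Gamma z * (-1) ^ n / pochhammer (1 - z) n"
proof -
  have zn: "z - of_nat n \<notin> \<int>"
  proof
    assume "z - of_nat n \<in> \<int>"
    from Ints_add[OF this Ints_of_nat[of n]] show False using assms by simp
  qed
  have "1 - z \<notin> \<int>"
  proof
    assume "1 - z \<in> \<int>"
    from Ints_diff[OF Ints_1 this] show False using assms by simp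
  qed
  then have nz: "pochhammer (1 - z) n \<noteq> 0" by (rule pochhammer_not_Int_nonzero)
  have "Gamma z = Gamma (z - of_nat n) * pochhammer (z - of_nat n) n"
    using Gamma_plus_of_nat[OF zn, of n] by simp
  moreover have "pochhammer (1 - z) n = (-1) ^ n * pochhammer (z - of_nat n) n"
    using pochhammer_minus[of "z - 1" n] by (simp add: algebra_simps)
  ultimately have "Gamma z * (-1) ^ n = Gamma (z - of_nat n) * pochhammer (1 - z) n"
    by (simp add: mult.assoc mult.left_commute[of _ "(-1)^n"])
  then show ?thesis using nz by (simp add: field_simps)
qed

text \<open>Because C is nonzero, convergence of the integrated series already gives convergence of
  the hypergeometric series, which needs no separate ratio test.\<close>

lemma sums_cmult_unique:
  fixes C :: complex
  assumes "(\<lambda>n. C * h n) sums S" "C \<noteq> 0"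
  shows "S = C * suminf h"
proof -
  have "summable h" using assms by (simp add: sums_iff summable_cmult_iff)
  then show ?thesis using assms(1) by (simp add: sums_iff suminf_mult)
qed

section \<open>Summing the cells and matching coefficients\<close>

lemma twisted_integral_sums:
  assumes m: "m \<ge> 1" and k: "k \<le> m" and b0: "b 0 = 0"
    and ab: "\<forall>i\<le>m. \<forall>j\<le>m. a i - b j \<notin> \<int>"
    and bb: "\<forall>i j. i < j \<and> j \<le> m \<longrightarrow> b i - b j \<notin> \<int>"
    and e: "0 < \<epsilon>" "\<epsilon> < 1/2" and x: "0 < x"
    and small: "x * (\<Prod>j=1..m. zbound \<epsilon> (iota_sign k j)) < 1"
  defines "p \<equiv> \<lambda>j. expo0 a b k j + (if k = 0 then 0 else iota_sign k j)"
    and "q \<equiv> \<lambda>j. expo1 a b k j + (if j = k then 1 else 0)"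
    and "\<alpha> \<equiv> if k = 0 then a 0 else a k - b k + 1"
    and "K \<equiv> if k = 0 then 1 else exp (- of_real pi * \<i> * (b k - a k - 1)) * exp ((1 - b k) * of_real (ln x))"
  shows "(\<lambda>n. K * ((pochhammer \<alpha> n / fact n * of_real x ^ n) *
      (\<Prod>j=1..m. Gamma (p j + iota_sign k j * of_nat n) * Gamma (q j) / Gamma (p j + iota_sign k j * of_nat n + q j))))
    sums twisted_integral m a b x \<epsilon> k"
proof -
  let ?C = "reg_coef a b k"
  let ?F = "\<lambda>c s. (\<Prod>j=1..m. cell_factor \<epsilon> (c j) (p j) (q j) (s j)) *
      exp (- \<alpha> * Ln (1 - cell_arg m x (iota_sign k) \<epsilon> c s))"
  have cell: "cell_integral m a b x \<epsilon> k c = K * integral\<^sup>L (unit_cube_measure m) (?F c)" for c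
  proof -
    interpret twisted_cell m k x \<epsilon> c by unfold_locales (fact m k e x small)+
    have "cell_integral m a b x \<epsilon> k c = integral\<^sup>L (unit_cube_measure m) (\<lambda>s. K * ?F c s)"
      unfolding cell_integral_def Let_def p_def q_def \<alpha>_def K_def
      by (intro Bochner_Integration.integral_cong refl integrand_eq b0)
         (simp add: space_PiM pcube_def)
    then show ?thesis by simp
  qed
  have int: "(if k = 0 then 0 else iota_sign k j) \<in> \<int>" "(if j = k then 1 else 0 :: complex) \<in> \<int>" for j
    by (auto simp: iota_sign_def)
  have notint: "u + d \<notin> \<int>" if "u \<notin> \<int>" "d \<in> \<int>" for u d :: complex
    using Ints_diff[of "u + d" d] that by auto
  have flip: "v - u \<notin> \<int>" if "u - v \<notin> \<int>" for u v :: complex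
    using Ints_minus[of "v - u"] that by auto
  \<comment> \<open>The genericity assumptions become non-integrality of the local exponents; those
    at j = k are b_k = b_k - b_0 and -a_0 = -(a_0 - b_0), by \<open>b 0 = 0\<close>.\<close>
  have e0: "expo0 a b k j \<notin> \<int>" if "j \<in> {1..m}" for j
    using that ab k bb[rule_format, of 0 k] flip[of "b 0" "b k"] b0 by (auto simp: expo0_def)
  have e1: "expo1 a b k j \<notin> \<int>" if "j \<in> {1..m}" for j
    using that ab[rule_format, of j j] flip[of "a j" "b j"] ab[rule_format, of 0 0] b0 by (auto simp: expo1_def)
  have "(\<lambda>n. ((- \<alpha> gchoose n) * (-1) ^ n * of_real x ^ n) *
      (\<Prod>j=1..m. Gamma (p j + iota_sign k j * of_nat n) * Gamma (q j) / Gamma (p j + iota_sign k j * of_nat n + q j)))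
    sums (\<Sum>c\<in>PiE {1..m} (\<lambda>_. {0,1,2::nat}). (\<Prod>j=1..m. ?C j (c j)) * integral\<^sup>L (unit_cube_measure m) (?F c))"
  proof (rule regularized_sums[OF e _ x small])
    fix j assume j: "j \<in> {1..m}"
    show "p j \<notin> \<int>" unfolding p_def by (rule notint[OF e0[OF j] int(1)])
    show "q j \<notin> \<int>" unfolding q_def by (rule notint[OF e1[OF j] int(2)])
    show "?C j 0 = 1 / (exp (2 * pi * \<i> * p j) - 1)"
      unfolding p_def exp_2pi_shift[OF int(1)] by (simp add: reg_coef_def)
    show "?C j 2 = - 1 / (exp (2 * pi * \<i> * q j) - 1)"
      unfolding q_def exp_2pi_shift[OF int(2)] by (simp add: reg_coef_def)
  qed (auto simp: iota_sign_def reg_coef_def)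
  from sums_mult[OF this, of K]
  show ?thesis
    unfolding one_minus_powr_coeff twisted_integral_def cell
    by (simp add: sum_distrib_left mult.left_commute)
qed

text \<open>For k > 0, Q has m - 1 factors of modulus at most 1 + \<epsilon> and one factor 1/z_k of
  modulus at most 1/\<epsilon>; the bound on x is exactly what this requires. For k = 0 it gives |Q|
  < \<epsilon> (1 + \<epsilon>) < 1.\<close>

lemma cell_arg_bound_less_1:
  fixes x \<epsilon> :: real
  assumes m: "m \<ge> 1" and eps: "0 < \<epsilon>" "\<epsilon> < 1/2"
    and xpos: "0 < x" and xsmall: "x < \<epsilon> / (1 + \<epsilon>) ^ (m - 1)"
    and k: "k \<le> m"
  shows "x * (\<Prod>j=1..m. zbound \<epsilon> (iota_sign k j)) < 1"
proof -
  have pos: "0 < (1 + \<epsilon>) ^ (m - 1)" using eps by simp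
  have small: "x * (1 + \<epsilon>) ^ (m - 1) < \<epsilon>" using xsmall pos by (simp add: field_simps)
  show ?thesis
  proof (cases "k = 0")
    case True
    have "(\<Prod>j=1..m. zbound \<epsilon> (iota_sign k j)) = (\<Prod>j=1..m. 1 + \<epsilon>)"
      using True by (intro prod.cong) (auto simp: zbound_def iota_sign_def)
    also have "\<dots> = (1 + \<epsilon>) ^ (m - 1) * (1 + \<epsilon>)"
      using m power_minus_mult[of m "1 + \<epsilon>"] by simp
    finally have "x * (\<Prod>j=1..m. zbound \<epsilon> (iota_sign k j)) = x * (1 + \<epsilon>) ^ (m - 1) * (1 + \<epsilon>)" by simp
    also have "\<dots> < \<epsilon> * (1 + \<epsilon>)" using small eps by (intro mult_strict_right_mono) auto
    also have "\<dots> < (1/2) * 2" using eps by (intro mult_strict_mono) auto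
    finally show ?thesis by simp
  next
    case False
    then have kin: "k \<in> {1..m}" using k by auto
    have "(\<Prod>j\<in>{1..m}-{k}. zbound \<epsilon> (iota_sign k j)) = (\<Prod>j\<in>{1..m}-{k}. 1 + \<epsilon>)"
      by (intro prod.cong) (auto simp: zbound_def iota_sign_def)
    then have "(\<Prod>j=1..m. zbound \<epsilon> (iota_sign k j)) = 1 / \<epsilon> * (1 + \<epsilon>) ^ (m - 1)"
      unfolding prod.remove[OF finite_atLeastAtMost kin] using kin
      by (simp add: zbound_def[of _ "-1"] iota_sign_def[of k k])
    then have "x * (\<Prod>j=1..m. zbound \<epsilon> (iota_sign k j)) = x * (1 + \<epsilon>) ^ (m - 1) / \<epsilon>" by simp
    then show ?thesis using small eps by simp
  qed
qed

theorem theorem4p2: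
  fixes m :: nat and a b :: "nat \<Rightarrow> complex" and x \<epsilon> :: real
  assumes m: "m \<ge> 1"
    and b0: "b 0 = 0"
    and ab: "\<forall>i\<le>m. \<forall>j\<le>m. a i - b j \<notin> \<int>"
    and bb: "\<forall>i j. i < j \<and> j \<le> m \<longrightarrow> b i - b j \<notin> \<int>"
    and eps: "0 < \<epsilon>" "\<epsilon> < 1/2"
    and xpos: "0 < x" and xsmall: "x < \<epsilon> / (1 + \<epsilon>) ^ (m - 1)"
  shows "twisted_integral m a b x \<epsilon> 0 =
           (\<Prod>i=1..m. Gamma (a i) * Gamma (b i - a i) / Gamma (b i))
             * hypergeom m a (\<lambda>j. b j) (complex_of_real x)
       \<and> (\<forall>r\<in>{1..m}. twisted_integral m a b x \<epsilon> r =
           exp (- complex_of_real pi * \<i> * (b r - a r - 1))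
             * (Gamma (b r - 1) * Gamma (1 - a 0) / Gamma (b r - a 0))
             * (\<Prod>j\<in>{1..m} - {r}. Gamma (a j - b r + 1) * Gamma (b j - a j) / Gamma (b j - b r + 1))
             * (complex_of_real x powr (1 - b r)
                * hypergeom m (\<lambda>i. a i - b r + 1)
                    (\<lambda>j. if j = r then 2 - b r else b j - b r + 1) (complex_of_real x)))"
proof (intro conjI ballI)
  note small = cell_arg_bound_less_1[OF m eps xpos xsmall]
  have plus: "u + d \<notin> \<int>" if "u \<notin> \<int>" "d \<in> \<int>" for u d :: complex
    using Ints_diff[of "u + d" d] that by auto
  have flip: "v - u \<notin> \<int>" if "u - v \<notin> \<int>" for u v :: complex
    using Ints_minus[of "v - u"] that by auto
  have aZ: "a j \<notin> \<int>" if "j \<le> m" for j using ab[rule_format, of j 0] that b0 by simp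
  have bbZ: "b i - b j \<notin> \<int>" if "i \<le> m" "j \<le> m" "i \<noteq> j" for i j
    using bb flip that by (metis linorder_neqE_nat)
  have bZ: "b j \<notin> \<int>" if "j \<in> {1..m}" for j using bbZ[of j 0] that b0 by simp
  have baZ: "b i - a j \<notin> \<int>" if "i \<le> m" "j \<le> m" for i j using ab that flip by blast
  have G: "Gamma z \<noteq> 0" if "z \<notin> \<int>" for z :: complex
    using not_Int_not_nonpos[OF that] by (simp add: Gamma_eq_zero_iff)
  {
    let ?C = "\<Prod>i=1..m. Gamma (a i) * Gamma (b i - a i) / Gamma (b i)"
    have C: "?C \<noteq> 0"
      using aZ bZ baZ by (auto simp: prod_zero_iff G)
    have term1: "Gamma (a j + of_nat n) * Gamma (b j - a j) / Gamma (a j + of_nat n + (b j - a j))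
       = (Gamma (a j) * Gamma (b j - a j) / Gamma (b j)) * (pochhammer (a j) n / pochhammer (b j) n)"
      if j: "j \<in> {1..m}" for j n
    proof -
      have eq: "a j + of_nat n + (b j - a j) = b j + of_nat n" by simp
      have "a j \<notin> \<int>" using j by (intro aZ) simp
      then show ?thesis unfolding eq Gamma_plus_of_nat[OF bZ[OF j]] by (simp add: Gamma_plus_of_nat)
    qed
    have "(\<lambda>n. (pochhammer (a 0) n / fact n * of_real x ^ n) *
      (\<Prod>j=1..m. Gamma (a j + of_nat n) * Gamma (b j - a j) / Gamma (a j + of_nat n + (b j - a j))))
      sums twisted_integral m a b x \<epsilon> 0"
    proof -
      have "(\<Prod>j=1..m. Gamma (expo0 a b 0 j + iota_sign 0 j * of_nat n) * Gamma (expo1 a b 0 j + (if j = 0 then 1 else 0))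
          / Gamma (expo0 a b 0 j + iota_sign 0 j * of_nat n + (expo1 a b 0 j + (if j = 0 then 1 else 0))))
        = (\<Prod>j=1..m. Gamma (a j + of_nat n) * Gamma (b j - a j) / Gamma (a j + of_nat n + (b j - a j)))" for n
        by (intro prod.cong) (auto simp: expo0_def expo1_def iota_sign_def b0)
      then show ?thesis
        using twisted_integral_sums[where a = a and b = b and k = 0, OF m _ b0 ab bb eps xpos small] by simp
    qed
    also have "(\<lambda>n. (pochhammer (a 0) n / fact n * of_real x ^ n) *
      (\<Prod>j=1..m. Gamma (a j + of_nat n) * Gamma (b j - a j) / Gamma (a j + of_nat n + (b j - a j))))
      = (\<lambda>n. ?C * ((\<Prod>i=0..m. pochhammer (a i) n) / ((\<Prod>i=1..m. pochhammer (b i) n) * fact n) * of_real x ^ n))"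
    proof
      fix n
      have num: "(\<Prod>j=1..m. Gamma (a j + of_nat n) * Gamma (b j - a j) / Gamma (a j + of_nat n + (b j - a j)))
        = ?C * ((\<Prod>j=1..m. pochhammer (a j) n) / (\<Prod>j=1..m. pochhammer (b j) n))"
        by (simp only: prod_dividef[symmetric] prod.distrib[symmetric]) (intro prod.cong refl term1)
      have split: "(\<Prod>i=0..m. pochhammer (a i) n) = pochhammer (a 0) n * (\<Prod>i=1..m. pochhammer (a i) n)"
        by (simp add: prod.atLeast_Suc_atMost)
      show "(pochhammer (a 0) n / fact n * of_real x ^ n) *
        (\<Prod>j=1..m. Gamma (a j + of_nat n) * Gamma (b j - a j) / Gamma (a j + of_nat n + (b j - a j)))
        = ?C * ((\<Prod>i=0..m. pochhammer (a i) n) / ((\<Prod>i=1..m. pochhammer (b i) n) * fact n) * of_real x ^ n)"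
        unfolding num split
        by (simp only: times_divide_eq_left times_divide_eq_right divide_divide_eq_left mult_ac)
    qed
    finally show "twisted_integral m a b x \<epsilon> 0 = ?C * hypergeom m a (\<lambda>j. b j) (complex_of_real x)"
      unfolding hypergeom_def by (rule sums_cmult_unique[OF _ C])
  }
  fix r assume r: "r \<in> {1..m}"
  let ?E = "exp (- complex_of_real pi * \<i> * (b r - a r - 1))"
  let ?R = "Gamma (b r - 1) * Gamma (1 - a 0) / Gamma (b r - a 0)"
  let ?P = "\<Prod>j\<in>{1..m} - {r}. Gamma (a j - b r + 1) * Gamma (b j - a j) / Gamma (b j - b r + 1)"
  let ?X = "complex_of_real x powr (1 - b r)"
  let ?\<beta> = "\<lambda>j. if j = r then 2 - b r else b j - b r + 1"
  let ?h = "\<lambda>n. (\<Prod>i=0..m. pochhammer (a i - b r + 1) n) / ((\<Prod>i=1..m. pochhammer (?\<beta> i) n) * fact n) * of_real x ^ n"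
  have X: "?X = exp ((1 - b r) * of_real (ln x))" using xpos by (simp add: powr_def Ln_of_real)
  have r0: "r \<noteq> 0" "r \<le> m" using r by auto
  have Z1: "a j - b r + 1 \<notin> \<int>" if "j \<le> m" for j
    using ab[rule_format, OF that r0(2)] by (intro plus) auto
  have Z2: "b j - b r + 1 \<notin> \<int>" if "j \<in> {1..m} - {r}" for j
    using bbZ[of j r] that r0 by (intro plus) auto
  have Z3: "b r - 1 \<notin> \<int>" using plus[OF bZ[OF r], of "-1"] by simp
  have Z4: "1 - a 0 \<notin> \<int>" using plus[OF flip[of "a 0" 0], of 1] aZ[of 0] by simp
  have Z5: "b r - a 0 \<notin> \<int>" using baZ r0 by simp
  have C: "?E * ?R * ?P * ?X \<noteq> 0"
  proof -
    have "?P \<noteq> 0" using Z1 Z2 baZ by (auto simp: prod_zero_iff G)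
    then show ?thesis using Z3 Z4 Z5 G X by simp
  qed
  let ?p = "\<lambda>j. expo0 a b r j + iota_sign r j" and ?q = "\<lambda>j. expo1 a b r j + (if j = r then 1 else 0)"
  let ?B = "\<lambda>n j. Gamma (?p j + iota_sign r j * of_nat n) * Gamma (?q j) / Gamma (?p j + iota_sign r j * of_nat n + ?q j)"
  have "(\<lambda>n. ?E * ?X * ((pochhammer (a r - b r + 1) n / fact n * of_real x ^ n) * (\<Prod>j=1..m. ?B n j)))
    sums twisted_integral m a b x \<epsilon> r"
    unfolding X
    using twisted_integral_sums[where a = a and b = b and k = r, OF m r0(2) b0 ab bb eps xpos small[OF r0(2)]] r0
    by simp
  also have "(\<lambda>n. ?E * ?X * ((pochhammer (a r - b r + 1) n / fact n * of_real x ^ n) * (\<Prod>j=1..m. ?B n j)))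
    = (\<lambda>n. (?E * ?R * ?P * ?X) * ?h n)"
  proof
    fix n
    let ?A = "\<lambda>j. pochhammer (a j - b r + 1) n"
    \<comment> \<open>Both Gamma functions with argument depending on n are shifted downwards: the
      numerator yields 1/(2 - b_r)_n, the denominator yields (a_0 - b_r + 1)_n, and the signs (-1)^n
      cancel. The upper parameter with index r comes from the binomial series instead.\<close>
    have Br: "?B n r = ?R * (?A 0 / pochhammer (2 - b r) n)"
    proof -
      have 1: "?p r + iota_sign r r * of_nat n = (b r - 1) - of_nat n"
        by (simp add: expo0_def iota_sign_def)
      have 2: "?p r + iota_sign r r * of_nat n + ?q r = (b r - a 0) - of_nat n"
        by (simp add: expo0_def expo1_def iota_sign_def)
      have 3: "?q r = 1 - a 0" by (simp add: expo1_def)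
      have 4: "1 - (b r - 1) = 2 - b r" "1 - (b r - a 0) = a 0 - b r + 1" by simp_all
      have "?A 0 \<noteq> 0" using Z1[of 0] by (intro pochhammer_not_Int_nonzero) simp
      then show ?thesis
        unfolding 2 unfolding 3 unfolding 1 Gamma_minus_of_nat[OF Z3] Gamma_minus_of_nat[OF Z5] 4 by (simp add: mult_ac)
    qed
    have Bj: "?B n j = (Gamma (a j - b r + 1) * Gamma (b j - a j) / Gamma (b j - b r + 1))
        * (?A j / pochhammer (b j - b r + 1) n)" if j: "j \<in> {1..m} - {r}" for j
    proof -
      have 1: "?p j + iota_sign r j * of_nat n = (a j - b r + 1) + of_nat n"
        using j by (simp add: expo0_def iota_sign_def)
      have 2: "?p j + iota_sign r j * of_nat n + ?q j = (b j - b r + 1) + of_nat n"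
        using j by (simp add: expo0_def expo1_def iota_sign_def)
      have 3: "?q j = b j - a j" using j by (simp add: expo1_def)
      have "a j - b r + 1 \<notin> \<int>" using j by (intro Z1) auto
      then show ?thesis
        unfolding 2 unfolding 3 unfolding 1 Gamma_plus_of_nat[OF Z2[OF j]] by (simp add: Gamma_plus_of_nat)
    qed
    have "(\<Prod>j\<in>{1..m}-{r}. ?B n j) = (\<Prod>j\<in>{1..m}-{r}. (Gamma (a j - b r + 1) * Gamma (b j - a j) / Gamma (b j - b r + 1))
        * (?A j / pochhammer (b j - b r + 1) n))"
      by (intro prod.cong refl Bj)
    also have "\<dots> = ?P * ((\<Prod>j\<in>{1..m}-{r}. ?A j) / (\<Prod>j\<in>{1..m}-{r}. pochhammer (b j - b r + 1) n))"
      by (simp only: prod_dividef prod.distrib)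
    finally have B: "(\<Prod>j=1..m. ?B n j) = ?R * (?A 0 / pochhammer (2 - b r) n)
        * (?P * ((\<Prod>j\<in>{1..m}-{r}. ?A j) / (\<Prod>j\<in>{1..m}-{r}. pochhammer (b j - b r + 1) n)))"
      unfolding prod.remove[OF finite_atLeastAtMost r, of "?B n"] Br by simp
    have num: "(\<Prod>i=0..m. ?A i) = ?A 0 * (?A r * (\<Prod>j\<in>{1..m}-{r}. ?A j))"
      using prod.remove[OF finite_atLeastAtMost r, of ?A] by (simp add: prod.atLeast_Suc_atMost)
    have den: "(\<Prod>i=1..m. pochhammer (?\<beta> i) n) = pochhammer (2 - b r) n * (\<Prod>j\<in>{1..m}-{r}. pochhammer (b j - b r + 1) n)"
      using prod.remove[OF finite_atLeastAtMost r, of "\<lambda>i. pochhammer (?\<beta> i) n"] by simp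
    show "?E * ?X * ((?A r / fact n * of_real x ^ n) * (\<Prod>j=1..m. ?B n j)) = (?E * ?R * ?P * ?X) * ?h n"
      unfolding B num den by (simp only: times_divide_eq_left times_divide_eq_right divide_divide_eq_left mult_ac)
  qed
  finally have "twisted_integral m a b x \<epsilon> r = (?E * ?R * ?P * ?X) * suminf ?h"
    by (rule sums_cmult_unique[OF _ C])
  then show "twisted_integral m a b x \<epsilon> r = ?E * ?R * ?P * (?X *
      hypergeom m (\<lambda>i. a i - b r + 1) ?\<beta> (complex_of_real x))"
    unfolding hypergeom_def by (simp only: mult.assoc)
qed

end
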